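(* Let $A$ be a local ring with maximal ideal $\mathfrak{m}$, $M$ a finitely generated $A$-module, and $a_1,\ldots,a_r\in\mathfrak{m}$ an absolutely superficial $M$-sequence with $(a_1,\ldots,a_{r-1})M:a_r\neq M$. Put $\mathfrak{q}=(a_1,\ldots,a_r)$. Then $R_{\mathfrak{q}}(M)\cong S_{\mathfrak{q}}(M)$ naturally, i.e. the canonical surjection $S_{\mathfrak{q}}(M)\to R_{\mathfrak{q}}(M)$ is an isomorphism.
   Context: Local rings are commutative and Noetherian. For a submodule $N$ of a module $L$ and $a\in A$, $N:a=\{x\in L: ax\in N\}$. For $a_1,\ldots,a_r\in\mathfrak{m}$ put $\mathfrak{q}_i=(a_1,\ldots,a_i)$, $\mathfrak{q}_0=0$, $\mathfrak{q}=\mathfrak{q}_r$. The sequence $a_1,\ldots,a_r$ is an absolutely superficial $M$-sequence if for each $i=1,\ldots,r$, with $M_{i-1}:=M/\mathfrak{q}_{i-1}M$, one has $(\mathfrak{q}^{n+1}M_{i-1}:a_i)\cap\mathfrak{q}M_{i-1}=\mathfrak{q}^nM_{i-1}$ for all sufficiently large $n$. Let $A[X]=A[X_1,\ldots,X_r]$ and $M[X]=M\otimes_AA[X]$; elements of $M[X]$ are regarded as polynomials with coefficients in $M$, which can be evaluated at $(a_1,\ldots,a_r)$ to give an element of $M$; a form is a homogeneous polynomial. $R_{\mathfrak{q}}(M)$ (the Rees module) is the quotient of $M[X]$ by the $A[X]$-submodule generated by all forms of $M[X]$ vanishing at $a_1,\ldots,a_r$. $S_{\mathfrak{q}}(M)$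 (the symmetric module) is the quotient of $M[X]$ by the $A[X]$-submodule generated by all linear forms of $M[X]$ vanishing at $a_1,\ldots,a_r$. *)

theory Defs
  imports "HOL-Algebra.Module" "HOL-Algebra.Ring_Divisibility" "HOL-Algebra.Ideal_Product"
    "HOL-Library.Multiset"
begin

text \<open>Rings and modules are those of HOL-Algebra. Sequences \<open>a\<^sub>1, \<dots>, a\<^sub>r\<close> are functions
  on \<open>nat\<close> of which only the values at \<open>1, \<dots>, r\<close> matter.\<close>

section \<open>Commutative algebra\<close>

definition local_ring :: "('a, 'x) ring_scheme \<Rightarrow> 'a set \<Rightarrow> bool" where
  "local_ring A \<mm> \<longleftrightarrow> cring A \<and> noetherian_ring A \<and>
     maximalideal \<mm> A \<and> (\<forall>I. maximalideal I A \<longrightarrow> I = \<mm>)"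

definition submod_gen :: "('a, 'x) ring_scheme \<Rightarrow> ('a, 'b, 'y) module_scheme \<Rightarrow> 'b set \<Rightarrow> 'b set" where
  "submod_gen A M S = \<Inter>{N. submodule N A M \<and> S \<subseteq> N}"

definition fin_gen_module :: "('a, 'x) ring_scheme \<Rightarrow> ('a, 'b, 'y) module_scheme \<Rightarrow> bool" where
  "fin_gen_module A M \<longleftrightarrow> module A M \<and>
     (\<exists>S. finite S \<and> S \<subseteq> carrier M \<and> submod_gen A M S = carrier M)"

text \<open>The submodule \<open>IM\<close>.\<close>

definition ideal_smult :: "('a, 'x) ring_scheme \<Rightarrow> 'a set \<Rightarrow> ('a, 'b, 'y) module_scheme \<Rightarrow> 'b set" where
  "ideal_smult A I M = submod_gen A M {c \<odot>\<^bsub>M\<^esub> x | c x. c \<in> I \<and> x \<in> carrier M}"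

text \<open>\<open>I\<^sup>n\<close>, with \<open>I\<^sup>0\<close> the unit ideal.\<close>

definition ideal_pow :: "('a, 'x) ring_scheme \<Rightarrow> 'a set \<Rightarrow> nat \<Rightarrow> 'a set" where
  "ideal_pow A I n = I [^]\<^bsub>ideals_set A\<^esub> n"

text \<open>\<open>N : c\<close>, as a subset of \<open>M\<close>.\<close>

definition colon :: "('a, 'b, 'y) module_scheme \<Rightarrow> 'b set \<Rightarrow> 'a \<Rightarrow> 'b set" where
  "colon M N c = {x \<in> carrier M. c \<odot>\<^bsub>M\<^esub> x \<in> N}"

text \<open>\<open>M / N\<close>, on the cosets of \<open>N\<close>. The record type of modules extends that of rings; the fields
  \<open>mult\<close> and \<open>one\<close> have no meaning for a module and are left undefined.\<close>

definition quot_module :: "('a, 'b, 'y) module_scheme \<Rightarrow> 'b set \<Rightarrow> ('a, 'b set) module" where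
  "quot_module M N =
     \<lparr>carrier = a_rcosets\<^bsub>M\<^esub> N, mult = undefined, one = undefined,
      zero = N, add = set_add M,
      smult = (\<lambda>c X. \<Union>x\<in>X. N +>\<^bsub>M\<^esub> (c \<odot>\<^bsub>M\<^esub> x))\<rparr>"

text \<open>The canonical map \<open>x + N \<mapsto> x + N'\<close> from \<open>M / N\<close> to \<open>M / N'\<close>, for \<open>N \<subseteq> N'\<close>.\<close>

definition quot_map :: "('a, 'b, 'y) module_scheme \<Rightarrow> 'b set \<Rightarrow> 'b set \<Rightarrow> 'b set" where
  "quot_map M N' X = (\<Union>x\<in>X. N' +>\<^bsub>M\<^esub> x)"

definition mod_hom ::
  "('a, 'x) ring_scheme \<Rightarrow> ('a, 'b, 'y) module_scheme \<Rightarrow> ('a, 'c, 'z) module_scheme \<Rightarrow> ('b \<Rightarrow> 'c) set" where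
  "mod_hom A M N = {h \<in> carrier M \<rightarrow> carrier N.
     (\<forall>x\<in>carrier M. \<forall>y\<in>carrier M. h (x \<oplus>\<^bsub>M\<^esub> y) = h x \<oplus>\<^bsub>N\<^esub> h y) \<and>
     (\<forall>c\<in>carrier A. \<forall>x\<in>carrier M. h (c \<odot>\<^bsub>M\<^esub> x) = c \<odot>\<^bsub>N\<^esub> h x)}"

definition mod_iso ::
  "('a, 'x) ring_scheme \<Rightarrow> ('a, 'b, 'y) module_scheme \<Rightarrow> ('a, 'c, 'z) module_scheme \<Rightarrow> ('b \<Rightarrow> 'c) set" where
  "mod_iso A M N = {h \<in> mod_hom A M N. bij_betw h (carrier M) (carrier N)}"


section \<open>Absolutely superficial sequences\<close>

definition seq_ideal :: "('a, 'x) ring_scheme \<Rightarrow> (nat \<Rightarrow> 'a) \<Rightarrow> nat \<Rightarrow> 'a set" where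
  "seq_ideal A a i = Idl\<^bsub>A\<^esub> (a ` {1..i})"

definition seq_quot ::
  "('a, 'x) ring_scheme \<Rightarrow> ('a, 'b, 'y) module_scheme \<Rightarrow> (nat \<Rightarrow> 'a) \<Rightarrow> nat \<Rightarrow> ('a, 'b set) module" where
  "seq_quot A M a i = quot_module M (ideal_smult A (seq_ideal A a i) M)"

definition abs_superficial ::
  "('a, 'x) ring_scheme \<Rightarrow> ('a, 'b, 'y) module_scheme \<Rightarrow> nat \<Rightarrow> (nat \<Rightarrow> 'a) \<Rightarrow> bool" where
  "abs_superficial A M r a \<longleftrightarrow>
     (\<forall>i\<in>{1..r}.
        let \<qq> = seq_ideal A a r; M' = seq_quot A M a (i - 1) in
        \<exists>n\<^sub>0. \<forall>n\<ge>n\<^sub>0.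
          colon M' (ideal_smult A (ideal_pow A \<qq> (n + 1)) M') (a i) \<inter> ideal_smult A \<qq> M'
            = ideal_smult A (ideal_pow A \<qq> n) M')"


section \<open>Polynomials with coefficients in a ring or a module\<close>

text \<open>A monomial in \<open>X\<^sub>1, \<dots>, X\<^sub>r\<close> is a multiset over \<open>{1..r}\<close>, and a polynomial is the finitely
  supported function giving its coefficients. As modules are also rings as far as the record type is
  concerned, the same set of functions serves for \<open>A[X]\<close> and for \<open>M[X]\<close>.\<close>

definition mpoly_carrier :: "nat \<Rightarrow> ('b, 'x) ring_scheme \<Rightarrow> (nat multiset \<Rightarrow> 'b) set" where
  "mpoly_carrier r M = {f. (\<forall>m. f m \<in> carrier M) \<and> finite {m. f m \<noteq> \<zero>\<^bsub>M\<^esub>} \<and>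
     (\<forall>m. f m \<noteq> \<zero>\<^bsub>M\<^esub> \<longrightarrow> set_mset m \<subseteq> {1..r})}"

definition mpoly_ring :: "nat \<Rightarrow> ('a, 'x) ring_scheme \<Rightarrow> (nat multiset \<Rightarrow> 'a) ring" where
  "mpoly_ring r A =
     \<lparr>carrier = mpoly_carrier r A,
      mult = (\<lambda>p q m. \<Oplus>\<^bsub>A\<^esub>k\<in>{k. k \<subseteq># m}. p k \<otimes>\<^bsub>A\<^esub> q (m - k)),
      one = (\<lambda>m. if m = {#} then \<one>\<^bsub>A\<^esub> else \<zero>\<^bsub>A\<^esub>),
      zero = (\<lambda>m. \<zero>\<^bsub>A\<^esub>),
      add = (\<lambda>p q m. p m \<oplus>\<^bsub>A\<^esub> q m)\<rparr>"

text \<open>\<open>M[X]\<close> as a module over \<open>A[X]\<close>.\<close>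

definition mpoly_module ::
  "nat \<Rightarrow> ('a, 'b, 'y) module_scheme \<Rightarrow> (nat multiset \<Rightarrow> 'a, nat multiset \<Rightarrow> 'b) module" where
  "mpoly_module r M =
     \<lparr>carrier = mpoly_carrier r M, mult = undefined, one = undefined,
      zero = (\<lambda>m. \<zero>\<^bsub>M\<^esub>),
      add = (\<lambda>f g m. f m \<oplus>\<^bsub>M\<^esub> g m),
      smult = (\<lambda>p f m. \<Oplus>\<^bsub>M\<^esub>k\<in>{k. k \<subseteq># m}. p k \<odot>\<^bsub>M\<^esub> f (m - k))\<rparr>"

definition eval_monom :: "('a, 'x) ring_scheme \<Rightarrow> (nat \<Rightarrow> 'a) \<Rightarrow> nat multiset \<Rightarrow> 'a" where
  "eval_monom A a m = (\<Otimes>\<^bsub>A\<^esub>i\<in>set_mset m. a i [^]\<^bsub>A\<^esub> count m i)"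

definition eval_mpoly ::
  "('a, 'x) ring_scheme \<Rightarrow> ('a, 'b, 'y) module_scheme \<Rightarrow> (nat \<Rightarrow> 'a) \<Rightarrow> (nat multiset \<Rightarrow> 'b) \<Rightarrow> 'b" where
  "eval_mpoly A M a f = (\<Oplus>\<^bsub>M\<^esub>m\<in>{m. f m \<noteq> \<zero>\<^bsub>M\<^esub>}. eval_monom A a m \<odot>\<^bsub>M\<^esub> f m)"

text \<open>The forms of degree \<open>d\<close> in \<open>M[X]\<close>; the zero polynomial is a form of every degree.\<close>

definition forms :: "nat \<Rightarrow> ('a, 'b, 'y) module_scheme \<Rightarrow> nat \<Rightarrow> (nat multiset \<Rightarrow> 'b) set" where
  "forms r M d = {f \<in> mpoly_carrier r M. \<forall>m. f m \<noteq> \<zero>\<^bsub>M\<^esub> \<longrightarrow> size m = d}"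


section \<open>The Rees module and the symmetric module\<close>

definition rees_rel ::
  "('a, 'x) ring_scheme \<Rightarrow> ('a, 'b, 'y) module_scheme \<Rightarrow> nat \<Rightarrow> (nat \<Rightarrow> 'a) \<Rightarrow> (nat multiset \<Rightarrow> 'b) set" where
  "rees_rel A M r a = submod_gen (mpoly_ring r A) (mpoly_module r M)
     {f \<in> (\<Union>d. forms r M d). eval_mpoly A M a f = \<zero>\<^bsub>M\<^esub>}"

definition sym_rel ::
  "('a, 'x) ring_scheme \<Rightarrow> ('a, 'b, 'y) module_scheme \<Rightarrow> nat \<Rightarrow> (nat \<Rightarrow> 'a) \<Rightarrow> (nat multiset \<Rightarrow> 'b) set" where
  "sym_rel A M r a = submod_gen (mpoly_ring r A) (mpoly_module r M)
     {f \<in> forms r M 1. eval_mpoly A M a f = \<zero>\<^bsub>M\<^esub>}"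

text \<open>By this inclusion the identity of \<open>M[X]\<close> induces the surjection \<open>sym_to_rees\<close> below.\<close>

lemma sym_rel_subset_rees_rel: "sym_rel A M r a \<subseteq> rees_rel A M r a"
  unfolding sym_rel_def rees_rel_def submod_gen_def by blast

definition rees_module where
  "rees_module A M r a = quot_module (mpoly_module r M) (rees_rel A M r a)"

definition sym_module where
  "sym_module A M r a = quot_module (mpoly_module r M) (sym_rel A M r a)"

definition sym_to_rees where
  "sym_to_rees A M r a = quot_map (mpoly_module r M) (rees_rel A M r a)"

end

theory Submission
  imports Defs
begin

text \<open>Absolute superficiality and Krull's intersection theorem give
  \<open>(\<qq>\<^sub>i\<^sub>-\<^sub>1M : a\<^sub>i) \<inter> \<qq>M = \<qq>\<^sub>i\<^sub>-\<^sub>1M\<close> for all \<open>i\<close>. Let \<open>L\<close> be the submodule of \<open>M[X]\<close> generated by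
  the linear forms vanishing at \<open>a\<close>. By induction on \<open>d\<close> and descending induction on \<open>k\<close>, a form
  \<open>F\<close> of degree \<open>d \<ge> 1\<close> with \<open>F(a) \<in> \<qq>\<^sub>kM\<close> is congruent modulo \<open>L\<close> to a form in the submodule
  \<open>(X\<^sub>1, \<dots>, X\<^sub>k)M[X]\<close>: from \<open>k + 1\<close> we have \<open>F \<equiv> X\<^sub>k\<^sub>+\<^sub>1 G + H\<close> with \<open>H\<close> in \<open>(X\<^sub>1, \<dots>, X\<^sub>k)M[X]\<close>, hence
  \<open>a\<^sub>k\<^sub>+\<^sub>1 G(a) \<in> \<qq>\<^sub>kM\<close>, so \<open>G(a) \<in> \<qq>\<^sub>kM\<close> and the induction hypothesis applies to \<open>G\<close>. For \<open>k = 0\<close>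
  this says that every form vanishing at \<open>a\<close> lies in \<open>L\<close>.\<close>

section \<open>Submodules and quotient modules\<close>

text \<open>An intersection of submodules, over a family that contains the whole module. Only the
  additive group and closure under scalars are assumed, so that \<open>mpoly_module\<close> over
  \<open>mpoly_ring\<close> is covered without establishing all module axioms there.\<close>

lemma submod_gen_submodule:
  assumes "abelian_group M"
    and "\<And>c x. c \<in> carrier A \<Longrightarrow> x \<in> carrier M \<Longrightarrow> c \<odot>\<^bsub>M\<^esub> x \<in> carrier M"
    and "S \<subseteq> carrier M"
  shows "submodule (submod_gen A M S) A M"
proof -
  interpret abelian_group M by fact
  have carr: "submodule (carrier M) A M"
    by (intro submodule.intro add.subgroup_self) (use assms(2) in \<open>auto simp: submodule_axioms_def\<close>)
  have "subgroup (submod_gen A M S) (add_monoid M)"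
    unfolding submod_gen_def
    by (rule add.subgroups_Inter) (use carr assms(3) in \<open>auto simp: submodule_def\<close>)
  then show ?thesis
    by (auto simp: submodule_def submodule_axioms_def submod_gen_def)
qed

lemma submod_gen_subset: "S \<subseteq> submod_gen A M S"
  by (auto simp: submod_gen_def)

lemma submod_gen_least: "submodule N A M \<Longrightarrow> S \<subseteq> N \<Longrightarrow> submod_gen A M S \<subseteq> N"
  by (auto simp: submod_gen_def)

lemma submodule_zero: "submodule N A M \<Longrightarrow> \<zero>\<^bsub>M\<^esub> \<in> N"
  using subgroup.one_closed[OF submodule.axioms(1)] by fastforce

lemma submodule_add: "submodule N A M \<Longrightarrow> x \<in> N \<Longrightarrow> y \<in> N \<Longrightarrow> x \<oplus>\<^bsub>M\<^esub> y \<in> N"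
  using subgroup.m_closed[OF submodule.axioms(1)] by fastforce

lemma submodule_carrier: "submodule N A M \<Longrightarrow> N \<subseteq> carrier M"
  using subgroup.subset[OF submodule.axioms(1)] by fastforce

lemma abelian_subgroup_submodule:
  assumes "abelian_group M" "submodule N A M"
  shows "abelian_subgroup N M"
proof -
  interpret abelian_group M by fact
  show ?thesis
    by (intro abelian_subgroupI3 additive_subgroup.intro submodule.axioms(1)[OF assms(2)] assms(1))
qed

context module
begin

lemma uminus_eq_smult:
  assumes "x \<in> carrier M" shows "\<ominus>\<^bsub>M\<^esub> x = (\<ominus> \<one>) \<odot>\<^bsub>M\<^esub> x"
  using assms by (simp add: smult_l_minus)

text \<open>Closure under negation follows from closure under scalars, since a negative is a
  multiple by \<open>\<ominus> \<one>\<close>.\<close>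

lemma submoduleI':
  assumes "H \<subseteq> carrier M" "\<zero>\<^bsub>M\<^esub> \<in> H"
    and "\<And>x y. x \<in> H \<Longrightarrow> y \<in> H \<Longrightarrow> x \<oplus>\<^bsub>M\<^esub> y \<in> H"
    and "\<And>c x. c \<in> carrier R \<Longrightarrow> x \<in> H \<Longrightarrow> c \<odot>\<^bsub>M\<^esub> x \<in> H"
  shows "submodule H R M"
proof (rule submoduleI)
  show "\<ominus>\<^bsub>M\<^esub> x \<in> H" if "x \<in> H" for x
    using that assms(1,4) uminus_eq_smult[of x] by auto
qed (use assms in auto)

lemma submodule_add_cancel:
  assumes "submodule N R M" "x \<in> N" "x \<oplus>\<^bsub>M\<^esub> y \<in> N" "y \<in> carrier M"
  shows "y \<in> N"
proof -
  have x: "x \<in> carrier M" "\<ominus>\<^bsub>M\<^esub> x \<in> N"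
    using assms submoduleE[OF assms(1)] by auto
  then have "\<ominus>\<^bsub>M\<^esub> x \<oplus>\<^bsub>M\<^esub> (x \<oplus>\<^bsub>M\<^esub> y) \<in> N"
    using assms submodule_add by metis
  then show ?thesis using x assms by (simp add: M.r_neg1)
qed

lemma submodule_finsum:
  assumes "submodule N R M" "\<And>i. i \<in> I \<Longrightarrow> f i \<in> N"
  shows "finsum M f I \<in> N"
  using assms(2)
proof (induction I rule: infinite_finite_induct)
  case (insert i I)
  then have "f \<in> I \<rightarrow> carrier M" "f i \<in> carrier M"
    using submodule_carrier[OF assms(1)] by auto
  with insert show ?case
    by (simp add: submodule_add[OF assms(1)])
qed (use submodule_zero[OF assms(1)] in auto)

lemma ideal_smult_submodule:
  assumes "I \<subseteq> carrier R"
  shows "submodule (ideal_smult R I M) R M"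
  unfolding ideal_smult_def using assms
  by (intro submod_gen_submodule M.abelian_group_axioms) auto

lemma smult_in_ideal_smult: "c \<in> I \<Longrightarrow> x \<in> carrier M \<Longrightarrow> c \<odot>\<^bsub>M\<^esub> x \<in> ideal_smult R I M"
  unfolding ideal_smult_def using submod_gen_subset by fast

lemma ideal_smult_least:
  "submodule N R M \<Longrightarrow> (\<And>c x. c \<in> I \<Longrightarrow> x \<in> carrier M \<Longrightarrow> c \<odot>\<^bsub>M\<^esub> x \<in> N) \<Longrightarrow> ideal_smult R I M \<subseteq> N"
  unfolding ideal_smult_def by (rule submod_gen_least) auto

text \<open>The residual ideal \<open>N : S\<close>. It reduces claims about an ideal to its
  generators; with \<open>S\<close> a singleton it yields the ideals to which locality and the
  Noetherian condition are applied.\<close>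

lemma ideal_residual:
  assumes N: "submodule N R M" and S: "S \<subseteq> carrier M"
  shows "ideal {c \<in> carrier R. \<forall>x\<in>S. c \<odot>\<^bsub>M\<^esub> x \<in> N} R"
proof (rule idealI)
  let ?I = "{c \<in> carrier R. \<forall>x\<in>S. c \<odot>\<^bsub>M\<^esub> x \<in> N}"
  show "ring R" by (rule R.ring_axioms)
  show "subgroup ?I (add_monoid R)"
  proof (rule R.add.subgroupI)
    show "?I \<noteq> {}"
      using S submodule_zero[OF N] by (auto intro!: exI[of _ \<zero>])
    show "\<ominus> c \<in> ?I" if "c \<in> ?I" for c
      using that S submoduleE(3)[OF N] by (auto simp: smult_l_minus)
    show "c \<oplus> d \<in> ?I" if "c \<in> ?I" "d \<in> ?I" for c d
      using that S submodule_add[OF N] by (auto simp: smult_l_distr subset_iff)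
  qed auto
  show "d \<otimes> c \<in> ?I" if "c \<in> ?I" "d \<in> carrier R" for c d
    using that S submoduleE(4)[OF N] by (auto simp: smult_assoc1 subset_iff)
  then show "c \<otimes> d \<in> ?I" if "c \<in> ?I" "d \<in> carrier R" for c d
    using that R.m_comm[of c d] by simp
qed

end

text \<open>The scalar action on cosets is a union over representatives. It is constant because
  \<open>N\<close> is stable under \<open>c\<close>. The hypotheses are those available for
  polynomials over \<open>mpoly_ring\<close>.\<close>

lemma quot_smult:
  assumes "abelian_group M" "submodule N A M" "c \<in> carrier A" "x \<in> carrier M"
    and "\<And>y. y \<in> carrier M \<Longrightarrow> c \<odot>\<^bsub>M\<^esub> y \<in> carrier M"
    and "\<And>y z. y \<in> carrier M \<Longrightarrow> z \<in> carrier M \<Longrightarrow> c \<odot>\<^bsub>M\<^esub> (y \<oplus>\<^bsub>M\<^esub> z) = c \<odot>\<^bsub>M\<^esub> y \<oplus>\<^bsub>M\<^esub> c \<odot>\<^bsub>M\<^esub> z"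
  shows "c \<odot>\<^bsub>quot_module M N\<^esub> (N +>\<^bsub>M\<^esub> x) = N +>\<^bsub>M\<^esub> (c \<odot>\<^bsub>M\<^esub> x)"
proof -
  interpret abelian_subgroup N M by (rule abelian_subgroup_submodule[OF assms(1,2)])
  have N: "N \<subseteq> carrier M" by (rule a_subset)
  have "N +>\<^bsub>M\<^esub> (c \<odot>\<^bsub>M\<^esub> y) = N +>\<^bsub>M\<^esub> (c \<odot>\<^bsub>M\<^esub> x)" if y: "y \<in> N +>\<^bsub>M\<^esub> x" for y
  proof -
    obtain n where n: "n \<in> N" "y = n \<oplus>\<^bsub>M\<^esub> x" using y by (auto simp: a_r_coset_def')
    then have "c \<odot>\<^bsub>M\<^esub> y = c \<odot>\<^bsub>M\<^esub> n \<oplus>\<^bsub>M\<^esub> c \<odot>\<^bsub>M\<^esub> x" using N assms(4,6) by auto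
    moreover have "c \<odot>\<^bsub>M\<^esub> n \<in> N" using n assms(3) by (intro submodule.smult_closed[OF assms(2)])
    ultimately have "c \<odot>\<^bsub>M\<^esub> y \<in> N +>\<^bsub>M\<^esub> (c \<odot>\<^bsub>M\<^esub> x)" by (auto simp: a_r_coset_def')
    then show ?thesis using a_repr_independence' assms(4,5) by metis
  qed
  moreover have "x \<in> N +>\<^bsub>M\<^esub> x" using a_rcos_self[OF assms(4)] .
  ultimately have "(\<Union>y\<in>N +>\<^bsub>M\<^esub> x. N +>\<^bsub>M\<^esub> (c \<odot>\<^bsub>M\<^esub> y)) = N +>\<^bsub>M\<^esub> (c \<odot>\<^bsub>M\<^esub> x)"
    by (metis (no_types) SUP_eq_const empty_iff)
  then show ?thesis by (simp add: quot_module_def)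
qed

lemma quot_carrier_iff: "X \<in> carrier (quot_module M N) \<longleftrightarrow> (\<exists>x\<in>carrier M. X = N +>\<^bsub>M\<^esub> x)"
  by (auto simp: quot_module_def A_RCOSETS_def')

lemma quot_zero [simp]: "\<zero>\<^bsub>quot_module M N\<^esub> = N"
  by (simp add: quot_module_def)

lemma quot_add:
  assumes "abelian_group M" "submodule N A M" "x \<in> carrier M" "y \<in> carrier M"
  shows "(N +>\<^bsub>M\<^esub> x) \<oplus>\<^bsub>quot_module M N\<^esub> (N +>\<^bsub>M\<^esub> y) = N +>\<^bsub>M\<^esub> (x \<oplus>\<^bsub>M\<^esub> y)"
proof -
  interpret abelian_subgroup N M by (rule abelian_subgroup_submodule[OF assms(1,2)])
  show ?thesis using assms a_rcos_sum by (simp add: quot_module_def)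
qed

lemma quot_abelian_group:
  assumes "abelian_group M" "submodule N A M"
  shows "abelian_group (quot_module M N)"
proof -
  interpret abelian_subgroup N M by (rule abelian_subgroup_submodule[OF assms])
  note add = quot_add[OF assms]
  have zero: "N +>\<^bsub>M\<^esub> \<zero>\<^bsub>M\<^esub> = N" using a_rcos_const[OF submodule_zero[OF assms(2)]] by simp
  show ?thesis
  proof (rule abelian_groupI)
    show "\<zero>\<^bsub>quot_module M N\<^esub> \<in> carrier (quot_module M N)"
      using zero by (auto simp: quot_carrier_iff intro!: bexI[of _ "\<zero>\<^bsub>M\<^esub>"])
    show "X \<oplus>\<^bsub>quot_module M N\<^esub> Y \<in> carrier (quot_module M N)"
      if "X \<in> carrier (quot_module M N)" "Y \<in> carrier (quot_module M N)" for X Y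
      using that by (auto simp: quot_carrier_iff add)
    show "X \<oplus>\<^bsub>quot_module M N\<^esub> Y = Y \<oplus>\<^bsub>quot_module M N\<^esub> X"
      if "X \<in> carrier (quot_module M N)" "Y \<in> carrier (quot_module M N)" for X Y
      using that by (auto simp: quot_carrier_iff add a_comm)
    show "X \<oplus>\<^bsub>quot_module M N\<^esub> Y \<oplus>\<^bsub>quot_module M N\<^esub> Z
        = X \<oplus>\<^bsub>quot_module M N\<^esub> (Y \<oplus>\<^bsub>quot_module M N\<^esub> Z)"
      if "X \<in> carrier (quot_module M N)" "Y \<in> carrier (quot_module M N)"
        "Z \<in> carrier (quot_module M N)" for X Y Z
      using that by (auto simp: quot_carrier_iff add a_assoc)
    fix X assume "X \<in> carrier (quot_module M N)"
    then obtain x where x: "x \<in> carrier M" "X = N +>\<^bsub>M\<^esub> x"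
      by (auto simp: quot_carrier_iff)
    show "\<zero>\<^bsub>quot_module M N\<^esub> \<oplus>\<^bsub>quot_module M N\<^esub> X = X"
      using x add[of "\<zero>\<^bsub>M\<^esub>" x] zero by simp
    show "\<exists>Y\<in>carrier (quot_module M N). Y \<oplus>\<^bsub>quot_module M N\<^esub> X = \<zero>\<^bsub>quot_module M N\<^esub>"
      using x add[of "\<ominus>\<^bsub>M\<^esub> x" x] zero
      by (intro bexI[of _ "N +>\<^bsub>M\<^esub> (\<ominus>\<^bsub>M\<^esub> x)"]) (auto simp: quot_carrier_iff l_neg)
  qed
qed

context module
begin

lemma quot_smult':
  assumes "submodule N R M" "c \<in> carrier R" "x \<in> carrier M"
  shows "c \<odot>\<^bsub>quot_module M N\<^esub> (N +>\<^bsub>M\<^esub> x) = N +>\<^bsub>M\<^esub> (c \<odot>\<^bsub>M\<^esub> x)"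
  by (rule quot_smult[OF M.abelian_group_axioms assms]) (auto simp: assms smult_r_distr)

lemma quot_is_module:
  assumes N: "submodule N R M"
  shows "module R (quot_module M N)"
proof (rule moduleI[OF R.is_cring quot_abelian_group[OF M.abelian_group_axioms N]])
  note simps = quot_smult'[OF N] quot_add[OF M.abelian_group_axioms N]
  fix c d X Y
  assume c: "c \<in> carrier R" and "X \<in> carrier (quot_module M N)"
  then obtain x where x: "x \<in> carrier M" "X = N +>\<^bsub>M\<^esub> x" by (auto simp: quot_carrier_iff)
  show "c \<odot>\<^bsub>quot_module M N\<^esub> X \<in> carrier (quot_module M N)"
    using c x by (auto simp: simps quot_carrier_iff)
  {
    assume d: "d \<in> carrier R"
    show "(c \<oplus> d) \<odot>\<^bsub>quot_module M N\<^esub> X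
        = c \<odot>\<^bsub>quot_module M N\<^esub> X \<oplus>\<^bsub>quot_module M N\<^esub> d \<odot>\<^bsub>quot_module M N\<^esub> X"
      using c d x by (simp add: simps smult_l_distr)
    show "(c \<otimes> d) \<odot>\<^bsub>quot_module M N\<^esub> X = c \<odot>\<^bsub>quot_module M N\<^esub> (d \<odot>\<^bsub>quot_module M N\<^esub> X)"
      using c d x by (simp add: simps smult_assoc1)
  }
  assume "Y \<in> carrier (quot_module M N)"
  then obtain y where y: "y \<in> carrier M" "Y = N +>\<^bsub>M\<^esub> y" by (auto simp: quot_carrier_iff)
  show "c \<odot>\<^bsub>quot_module M N\<^esub> (X \<oplus>\<^bsub>quot_module M N\<^esub> Y)
      = c \<odot>\<^bsub>quot_module M N\<^esub> X \<oplus>\<^bsub>quot_module M N\<^esub> c \<odot>\<^bsub>quot_module M N\<^esub> Y"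
    using c x y by (simp add: simps smult_r_distr)
qed (use quot_smult'[OF N] in \<open>auto simp: quot_carrier_iff\<close>)

lemma coset_eq_iff:
  assumes N: "submodule N R M" and x: "x \<in> carrier M"
  shows "N +>\<^bsub>M\<^esub> x = N \<longleftrightarrow> x \<in> N"
proof -
  interpret abelian_subgroup N M
    by (rule abelian_subgroup_submodule[OF M.abelian_group_axioms N])
  show ?thesis using a_rcos_self[OF x] a_rcos_const by blast
qed

text \<open>The preimage of \<open>I(M/N)\<close> under the projection is a submodule containing
  every product \<open>c y\<close> with \<open>c \<in> I\<close>, hence all of
  \<open>IM\<close>.\<close>

lemma coset_in_ideal_smult_quot:
  assumes N: "submodule N R M" and I: "I \<subseteq> carrier R" and x: "x \<in> ideal_smult R I M"
  shows "N +>\<^bsub>M\<^esub> x \<in> ideal_smult R I (quot_module M N)"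
proof -
  interpret Q: module R "quot_module M N" by (rule quot_is_module[OF N])
  let ?P = "ideal_smult R I (quot_module M N)"
  have P: "submodule ?P R (quot_module M N)" by (rule Q.ideal_smult_submodule[OF I])
  have "submodule {y \<in> carrier M. N +>\<^bsub>M\<^esub> y \<in> ?P} R M"
  proof (rule submoduleI')
    show "\<zero>\<^bsub>M\<^esub> \<in> {y \<in> carrier M. N +>\<^bsub>M\<^esub> y \<in> ?P}"
      using submodule_zero[OF P] coset_eq_iff[OF N M.zero_closed] submodule_zero[OF N] by simp
    fix x y c
    assume x: "x \<in> {y \<in> carrier M. N +>\<^bsub>M\<^esub> y \<in> ?P}"
    show "x \<oplus>\<^bsub>M\<^esub> y \<in> {y \<in> carrier M. N +>\<^bsub>M\<^esub> y \<in> ?P}"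
      if "y \<in> {y \<in> carrier M. N +>\<^bsub>M\<^esub> y \<in> ?P}"
      using x that submodule_add[OF P, of "N +>\<^bsub>M\<^esub> x" "N +>\<^bsub>M\<^esub> y"]
        quot_add[OF M.abelian_group_axioms N, of x y] by auto
    show "c \<odot>\<^bsub>M\<^esub> x \<in> {y \<in> carrier M. N +>\<^bsub>M\<^esub> y \<in> ?P}" if "c \<in> carrier R"
      using x that submodule.smult_closed[OF P, of c "N +>\<^bsub>M\<^esub> x"] quot_smult'[OF N, of c x] by auto
  qed auto
  then have "ideal_smult R I M \<subseteq> {y \<in> carrier M. N +>\<^bsub>M\<^esub> y \<in> ?P}"
  proof (rule ideal_smult_least)
    fix c y assume cy: "c \<in> I" "y \<in> carrier M"
    then have "c \<odot>\<^bsub>quot_module M N\<^esub> (N +>\<^bsub>M\<^esub> y) \<in> ?P"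
      by (intro Q.smult_in_ideal_smult) (auto simp: quot_carrier_iff)
    then show "c \<odot>\<^bsub>M\<^esub> y \<in> {y \<in> carrier M. N +>\<^bsub>M\<^esub> y \<in> ?P}"
      using cy I by (auto simp: quot_smult'[OF N])
  qed
  then show ?thesis using x by auto
qed

text \<open>The image of \<open>N'\<close> in \<open>M/N\<close> is a submodule containing
  \<open>I(M/N)\<close>, so \<open>x\<close> differs from an element of \<open>N'\<close> by an
  element of \<open>N \<subseteq> N'\<close>.\<close>

lemma in_submodule_of_coset_in_ideal_smult_quot:
  assumes N: "submodule N R M" and N': "submodule N' R M" and NN': "N \<subseteq> N'"
    and I: "I \<subseteq> carrier R" and IN': "\<And>c y. c \<in> I \<Longrightarrow> y \<in> carrier M \<Longrightarrow> c \<odot>\<^bsub>M\<^esub> y \<in> N'"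
    and x: "x \<in> carrier M" "N +>\<^bsub>M\<^esub> x \<in> ideal_smult R I (quot_module M N)"
  shows "x \<in> N'"
proof -
  interpret Q: module R "quot_module M N" by (rule quot_is_module[OF N])
  interpret A: abelian_subgroup N M
    by (rule abelian_subgroup_submodule[OF M.abelian_group_axioms N])
  note carr = subsetD[OF submodule_carrier[OF N']]
  let ?P = "(\<lambda>y. N +>\<^bsub>M\<^esub> y) ` N'"
  have "submodule ?P R (quot_module M N)"
  proof (rule Q.submoduleI')
    show "?P \<subseteq> carrier (quot_module M N)" using carr by (force simp: quot_carrier_iff)
    show "\<zero>\<^bsub>quot_module M N\<^esub> \<in> ?P"
    proof (rule image_eqI)
      show "\<zero>\<^bsub>quot_module M N\<^esub> = N +>\<^bsub>M\<^esub> \<zero>\<^bsub>M\<^esub>"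
        using coset_eq_iff[OF N M.zero_closed] submodule_zero[OF N] by simp
    qed (rule submodule_zero[OF N'])
    fix X Y c
    assume "X \<in> ?P"
    then obtain x where x: "x \<in> N'" "X = N +>\<^bsub>M\<^esub> x" by auto
    show "X \<oplus>\<^bsub>quot_module M N\<^esub> Y \<in> ?P" if "Y \<in> ?P"
      using x that carr submodule_add[OF N']
      by (auto simp: quot_add[OF M.abelian_group_axioms N])
    show "c \<odot>\<^bsub>quot_module M N\<^esub> X \<in> ?P" if "c \<in> carrier R"
      using x that carr submodule.smult_closed[OF N', of c x]
      by (auto simp: quot_smult'[OF N])
  qed
  then have "ideal_smult R I (quot_module M N) \<subseteq> ?P"
    by (rule Q.ideal_smult_least) (use IN' I in \<open>auto simp: quot_carrier_iff quot_smult'[OF N]\<close>)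
  then obtain y where y: "y \<in> N'" "N +>\<^bsub>M\<^esub> x = N +>\<^bsub>M\<^esub> y" using x by auto
  then have "x \<in> N +>\<^bsub>M\<^esub> y" using A.a_rcos_self[OF x(1)] by simp
  then obtain n where "n \<in> N" "x = n \<oplus>\<^bsub>M\<^esub> y" by (auto simp: a_r_coset_def')
  then show ?thesis using y NN' submodule_add[OF N'] by auto
qed

end

section \<open>Krull's intersection theorem\<close>

text \<open>By Zorn's lemma a proper ideal lies in a maximal one, which can only be
  \<open>\<mm>\<close>. The union of a chain of proper ideals stays proper because in a Noetherian
  ring it belongs to the chain.\<close>

lemma local_ring_proper_ideal:
  assumes "local_ring R \<mm>" "ideal I R" "I \<noteq> carrier R"
  shows "I \<subseteq> \<mm>"
proof -
  interpret noetherian_ring R using assms(1) by (simp add: local_ring_def)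
  let ?A = "{J. ideal J R \<and> I \<subseteq> J \<and> J \<noteq> carrier R}"
  have "\<exists>J\<in>?A. \<forall>X\<in>?A. J \<subseteq> X \<longrightarrow> X = J"
  proof (rule subset_Zorn_nonempty)
    show "?A \<noteq> {}" using assms by auto
    show "\<Union>C \<in> ?A" if "C \<noteq> {}" "subset.chain ?A C" for C
    proof -
      have "C \<subseteq> ?A" "subset.chain {J. ideal J R} C"
        using that(2) unfolding subset_chain_def by (blast, blast)
      then show ?thesis using ideal_chain_is_trivial[OF that(1)] subsetD by metis
    qed
  qed
  then obtain J where J: "ideal J R" "I \<subseteq> J" "J \<noteq> carrier R"
    and max: "\<And>X. ideal X R \<Longrightarrow> I \<subseteq> X \<Longrightarrow> X \<noteq> carrier R \<Longrightarrow> J \<subseteq> X \<Longrightarrow> X = J"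
    by (smt (verit) mem_Collect_eq)
  have "maximalideal J R"
  proof (rule maximalidealI)
    show "X = J \<or> X = carrier R" if "ideal X R" "J \<subseteq> X" "X \<subseteq> carrier R" for X
      using max[of X] that J(2) by blast
  qed (use J in auto)
  then show ?thesis using J assms(1) by (auto simp: local_ring_def)
qed

lemma (in noetherian_ring) ascending_ideals_stabilize:
  assumes "\<And>k::nat. ideal (J k) R" "\<And>k. J k \<subseteq> J (Suc k)"
  shows "\<exists>t. \<forall>k. J k \<subseteq> J t"
proof -
  have mono: "J k \<subseteq> J l" if "k \<le> l" for k l
    using that by (rule lift_Suc_mono_le[of J, OF assms(2)])
  have "subset.chain {I. ideal I R} (range J)"
    unfolding subset_chain_def
  proof (intro conjI ballI)
    show "X \<subseteq> Y \<or> Y \<subseteq> X" if "X \<in> range J" "Y \<in> range J" for X Y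
      using that mono nat_le_linear by (metis imageE)
  qed (use assms(1) in auto)
  then have "\<Union>(range J) \<in> range J"
    by (intro ideal_chain_is_trivial) auto
  then show ?thesis by (metis UN_upper image_iff UNIV_I)
qed

context module
begin

text \<open>For fixed \<open>c\<close> the elements \<open>y\<close> with \<open>c y \<in> N\<close>
  form a submodule, as \<open>R\<close> is commutative; it contains the generators, hence
  everything.\<close>

lemma residual_generators:
  assumes N: "submodule N R M" and S: "S \<subseteq> carrier M" "submod_gen R M S = carrier M"
    and c: "c \<in> carrier R" "\<And>s. s \<in> S \<Longrightarrow> c \<odot>\<^bsub>M\<^esub> s \<in> N" and y: "y \<in> carrier M"
  shows "c \<odot>\<^bsub>M\<^esub> y \<in> N"
proof -
  have "submodule {y \<in> carrier M. c \<odot>\<^bsub>M\<^esub> y \<in> N} R M"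
  proof (rule submoduleI')
    show "d \<odot>\<^bsub>M\<^esub> y \<in> {y \<in> carrier M. c \<odot>\<^bsub>M\<^esub> y \<in> N}"
      if "d \<in> carrier R" "y \<in> {y \<in> carrier M. c \<odot>\<^bsub>M\<^esub> y \<in> N}" for d y
    proof -
      have "c \<odot>\<^bsub>M\<^esub> (d \<odot>\<^bsub>M\<^esub> y) = d \<odot>\<^bsub>M\<^esub> (c \<odot>\<^bsub>M\<^esub> y)"
        using that c(1) by (simp add: R.m_comm flip: smult_assoc1)
      then show ?thesis using that submoduleE(4)[OF N] by simp
    qed
  qed (use c(1) submodule_zero[OF N] submodule_add[OF N] in \<open>auto simp: smult_r_distr\<close>)
  from submod_gen_least[OF this, of S] show ?thesis using S c(2) y by auto
qed

text \<open>This is \<open>N + Ry\<close>, the larger submodule against which maximality is tested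
  in \<open>exists_maximal_avoiding\<close>.\<close>

lemma submodule_adjoin:
  assumes N: "submodule N R M" and y: "y \<in> carrier M"
  shows "submodule {n \<oplus>\<^bsub>M\<^esub> c \<odot>\<^bsub>M\<^esub> y | n c. n \<in> N \<and> c \<in> carrier R} R M" (is "submodule ?P R M")
proof (rule submoduleI')
  note carr = subsetD[OF submodule_carrier[OF N]]
  show "?P \<subseteq> carrier M" using carr y by auto
  show "\<zero>\<^bsub>M\<^esub> \<in> ?P"
    using submodule_zero[OF N] y by (intro CollectI exI[of _ "\<zero>\<^bsub>M\<^esub>"] exI[of _ \<zero>]) auto
  show "u \<oplus>\<^bsub>M\<^esub> v \<in> ?P" if uv: "u \<in> ?P" "v \<in> ?P" for u v
  proof -
    from uv obtain n c n' c' where *: "n \<in> N" "c \<in> carrier R" "u = n \<oplus>\<^bsub>M\<^esub> c \<odot>\<^bsub>M\<^esub> y"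
      "n' \<in> N" "c' \<in> carrier R" "v = n' \<oplus>\<^bsub>M\<^esub> c' \<odot>\<^bsub>M\<^esub> y" by blast
    then have "u \<oplus>\<^bsub>M\<^esub> v = (n \<oplus>\<^bsub>M\<^esub> n') \<oplus>\<^bsub>M\<^esub> (c \<oplus> c') \<odot>\<^bsub>M\<^esub> y"
      using carr y by (simp add: smult_l_distr M.a_ac)
    then show ?thesis using * submodule_add[OF N] by blast
  qed
  show "d \<odot>\<^bsub>M\<^esub> u \<in> ?P" if d: "d \<in> carrier R" and u: "u \<in> ?P" for d u
  proof -
    from u obtain n c where *: "n \<in> N" "c \<in> carrier R" "u = n \<oplus>\<^bsub>M\<^esub> c \<odot>\<^bsub>M\<^esub> y" by blast
    then have "d \<odot>\<^bsub>M\<^esub> u = d \<odot>\<^bsub>M\<^esub> n \<oplus>\<^bsub>M\<^esub> (d \<otimes> c) \<odot>\<^bsub>M\<^esub> y"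
      using carr y d by (simp add: smult_r_distr smult_assoc1)
    then show ?thesis using * d submoduleE(4)[OF N] by blast
  qed
qed

text \<open>Zorn's lemma applies because the union of a chain of submodules avoiding
  \<open>x\<close> avoids \<open>x\<close>. The last conclusion expresses maximality: for
  \<open>y\<close> outside \<open>N'\<close>, the submodule \<open>N' + Ry\<close> must contain
  \<open>x\<close>.\<close>

lemma exists_maximal_avoiding:
  assumes N: "submodule N R M" and x: "x \<in> carrier M" "x \<notin> N"
  obtains N' where "submodule N' R M" "N \<subseteq> N'" "x \<notin> N'"
    and "\<And>y. y \<in> carrier M \<Longrightarrow> y \<notin> N' \<Longrightarrow> \<exists>n\<in>N'. \<exists>c\<in>carrier R. x = n \<oplus>\<^bsub>M\<^esub> c \<odot>\<^bsub>M\<^esub> y"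
proof -
  let ?A = "{P. submodule P R M \<and> N \<subseteq> P \<and> x \<notin> P}"
  have "\<exists>P\<in>?A. \<forall>X\<in>?A. P \<subseteq> X \<longrightarrow> X = P"
  proof (rule subset_Zorn_nonempty)
    show "?A \<noteq> {}" using assms by auto
    fix C assume C: "C \<noteq> {}" "subset.chain ?A C"
    then have CA: "C \<subseteq> ?A" and comp: "\<And>P Q. P \<in> C \<Longrightarrow> Q \<in> C \<Longrightarrow> P \<subseteq> Q \<or> Q \<subseteq> P"
      by (auto simp: subset_chain_def)
    then have sub: "\<And>P. P \<in> C \<Longrightarrow> submodule P R M" by blast
    have "submodule (\<Union>C) R M"
    proof (rule submoduleI')
      show "\<Union>C \<subseteq> carrier M" using sub submodule_carrier by blast
      show "\<zero>\<^bsub>M\<^esub> \<in> \<Union>C" using C(1) sub submodule_zero by blast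
      show "u \<oplus>\<^bsub>M\<^esub> v \<in> \<Union>C" if uv: "u \<in> \<Union>C" "v \<in> \<Union>C" for u v
      proof -
        obtain P Q where PQ: "P \<in> C" "Q \<in> C" "u \<in> P" "v \<in> Q" using uv by blast
        obtain X where X: "X \<in> C" "u \<in> X" "v \<in> X"
          using comp[OF PQ(1,2)] PQ by blast
        show ?thesis using submodule_add[OF sub[OF X(1)] X(2,3)] X(1) by blast
      qed
      show "c \<odot>\<^bsub>M\<^esub> u \<in> \<Union>C" if "c \<in> carrier R" "u \<in> \<Union>C" for c u
        using that submodule.smult_closed[OF sub] by blast
    qed
    then show "\<Union>C \<in> ?A" using CA C(1) by blast
  qed
  then obtain P where P: "submodule P R M" "N \<subseteq> P" "x \<notin> P"
    and max: "\<And>X. submodule X R M \<Longrightarrow> N \<subseteq> X \<Longrightarrow> x \<notin> X \<Longrightarrow> P \<subseteq> X \<Longrightarrow> X = P"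
    by (smt (verit) mem_Collect_eq)
  show thesis
  proof (rule that[OF P])
    fix y assume y: "y \<in> carrier M" "y \<notin> P"
    let ?X = "{n \<oplus>\<^bsub>M\<^esub> c \<odot>\<^bsub>M\<^esub> y | n c. n \<in> P \<and> c \<in> carrier R}"
    have PX: "P \<subseteq> ?X"
    proof
      fix n assume "n \<in> P"
      moreover from this have "n = n \<oplus>\<^bsub>M\<^esub> \<zero> \<odot>\<^bsub>M\<^esub> y"
        using y submodule_carrier[OF P(1)] by auto
      ultimately show "n \<in> ?X" by blast
    qed
    have "y = \<zero>\<^bsub>M\<^esub> \<oplus>\<^bsub>M\<^esub> \<one> \<odot>\<^bsub>M\<^esub> y" using y by simp
    then have "y \<in> ?X" using submodule_zero[OF P(1)] by blast
    then have "x \<in> ?X"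
      using max[OF submodule_adjoin[OF P(1) y(1)]] PX P(2) y(2) by blast
    then show "\<exists>n\<in>P. \<exists>c\<in>carrier R. x = n \<oplus>\<^bsub>M\<^esub> c \<odot>\<^bsub>M\<^esub> y" by blast
  qed
qed

text \<open>Take \<open>N'\<close> maximal among the submodules containing \<open>N\<close> but not \<open>x\<close>; then \<open>\<mm>x \<subseteq> N'\<close>. For
  \<open>b \<in> \<mm>\<close> and \<open>s \<in> M\<close> let \<open>t\<close> be where the chain of ideals \<open>{c. c b\<^sup>k s \<in> N'}\<close> becomes stationary. If
  \<open>b\<^sup>t s \<notin> N'\<close>, then \<open>x \<equiv> c b\<^sup>t s\<close> modulo \<open>N'\<close> for some \<open>c\<close>, and \<open>b x \<in> N'\<close> forces \<open>x \<in> N'\<close>.\<close>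

lemma krull_separation:
  assumes loc: "local_ring R \<mm>" and fg: "fin_gen_module R M"
    and N: "submodule N R M" and x: "x \<in> carrier M" "x \<notin> N"
  obtains N' where "submodule N' R M" "N \<subseteq> N'" "x \<notin> N'"
    and "\<And>b. b \<in> \<mm> \<Longrightarrow> \<exists>t::nat. \<forall>y\<in>carrier M. (b [^] t) \<odot>\<^bsub>M\<^esub> y \<in> N'"
proof -
  interpret N: noetherian_ring R using loc by (simp add: local_ring_def)
  have mm: "maximalideal \<mm> R" using loc by (simp add: local_ring_def)
  then interpret mm: maximalideal \<mm> R .
  obtain N' where N': "submodule N' R M" "N \<subseteq> N'" "x \<notin> N'"
    and max: "\<And>y. y \<in> carrier M \<Longrightarrow> y \<notin> N' \<Longrightarrow> \<exists>n\<in>N'. \<exists>c\<in>carrier R. x = n \<oplus>\<^bsub>M\<^esub> c \<odot>\<^bsub>M\<^esub> y"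
    using exists_maximal_avoiding[OF N x] by metis
  note carr = subsetD[OF submodule_carrier[OF N'(1)]]
  obtain S where S: "finite S" "S \<subseteq> carrier M" "submod_gen R M S = carrier M"
    using fg by (auto simp: fin_gen_module_def)
  \<comment> \<open>Otherwise maximality gives \<open>x = n + c b x\<close>, so
    \<open>1 - c b\<close> lies in the residual ideal of \<open>x\<close>. That ideal is proper,
    hence inside \<open>\<mm>\<close>, and \<open>c b \<in> \<mm>\<close> would put \<open>1\<close>
    into \<open>\<mm>\<close>.\<close>
  have bx: "b \<odot>\<^bsub>M\<^esub> x \<in> N'" if b: "b \<in> \<mm>" for b
  proof (rule ccontr)
    assume "b \<odot>\<^bsub>M\<^esub> x \<notin> N'"
    moreover have bR: "b \<in> carrier R" using b mm.Icarr by auto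
    ultimately obtain n c where n: "n \<in> N'" "c \<in> carrier R" "x = n \<oplus>\<^bsub>M\<^esub> c \<odot>\<^bsub>M\<^esub> (b \<odot>\<^bsub>M\<^esub> x)"
      using max[of "b \<odot>\<^bsub>M\<^esub> x"] x(1) by auto
    let ?d = "\<one> \<ominus> c \<otimes> b"
    have cbx: "c \<odot>\<^bsub>M\<^esub> (b \<odot>\<^bsub>M\<^esub> x) \<in> carrier M" using n bR x by simp
    have "?d \<odot>\<^bsub>M\<^esub> x = x \<oplus>\<^bsub>M\<^esub> \<ominus>\<^bsub>M\<^esub> (c \<odot>\<^bsub>M\<^esub> (b \<odot>\<^bsub>M\<^esub> x))"
      using n(2) bR x(1) by (simp add: R.minus_eq smult_l_distr smult_l_minus smult_assoc1)
    also have "\<dots> = n"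
    proof -
      have "x \<oplus>\<^bsub>M\<^esub> \<ominus>\<^bsub>M\<^esub> (c \<odot>\<^bsub>M\<^esub> (b \<odot>\<^bsub>M\<^esub> x))
          = (n \<oplus>\<^bsub>M\<^esub> c \<odot>\<^bsub>M\<^esub> (b \<odot>\<^bsub>M\<^esub> x)) \<oplus>\<^bsub>M\<^esub> \<ominus>\<^bsub>M\<^esub> (c \<odot>\<^bsub>M\<^esub> (b \<odot>\<^bsub>M\<^esub> x))"
        using n(3) by simp
      then show ?thesis using n(1) carr cbx by (simp add: M.a_assoc M.r_neg)
    qed
    finally have d: "?d \<odot>\<^bsub>M\<^esub> x \<in> N'" using n(1) by simp
    let ?I = "{c \<in> carrier R. \<forall>y\<in>{x}. c \<odot>\<^bsub>M\<^esub> y \<in> N'}"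
    have "ideal ?I R" using x(1) by (intro ideal_residual N'(1)) auto
    moreover have "\<one> \<notin> ?I" using N'(3) x(1) by simp
    then have "?I \<noteq> carrier R" by blast
    ultimately have "?I \<subseteq> \<mm>" using local_ring_proper_ideal[OF loc] by blast
    then have "?d \<in> \<mm>" using d n(2) bR by auto
    moreover have "c \<otimes> b \<in> \<mm>" using b n(2) by (rule mm.I_l_closed)
    ultimately have "?d \<oplus> c \<otimes> b \<in> \<mm>" by (rule mm.a_closed)
    moreover have "?d \<oplus> c \<otimes> b = \<one>"
      using n(2) bR by (simp add: R.minus_eq R.a_assoc R.l_neg)
    ultimately have "\<one> \<in> \<mm>" by simp
    then have "\<mm> = carrier R" by (rule mm.one_imp_carrier)
    then show False using mm.I_notcarr by simp
  qed
  show thesis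
  proof (rule that[OF N'])
    fix b assume b: "b \<in> \<mm>"
    then have bR: "b \<in> carrier R" using mm.Icarr by auto
    have gen: "\<exists>t::nat. (b [^] t) \<odot>\<^bsub>M\<^esub> s \<in> N'" if s: "s \<in> carrier M" for s
    proof -
      define J where "J k = {c \<in> carrier R. \<forall>y\<in>{(b [^] k) \<odot>\<^bsub>M\<^esub> s}. c \<odot>\<^bsub>M\<^esub> y \<in> N'}" for k :: nat
      have step: "c \<odot>\<^bsub>M\<^esub> ((b [^] Suc k) \<odot>\<^bsub>M\<^esub> s) = b \<odot>\<^bsub>M\<^esub> (c \<odot>\<^bsub>M\<^esub> ((b [^] k) \<odot>\<^bsub>M\<^esub> s))"
        if "c \<in> carrier R" for c and k :: nat
        using that bR s by (simp add: R.m_ac flip: smult_assoc1)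
      have "\<exists>t. \<forall>k. J k \<subseteq> J t"
      proof (rule N.ascending_ideals_stabilize)
        show "ideal (J k) R" for k
          unfolding J_def using bR s by (intro ideal_residual N'(1)) auto
        show "J k \<subseteq> J (Suc k)" for k
          unfolding J_def using step bR submoduleE(4)[OF N'(1)] by auto
      qed
      then obtain t where t: "J (Suc t) \<subseteq> J t" by blast
      have "(b [^] t) \<odot>\<^bsub>M\<^esub> s \<in> N'"
      proof (rule ccontr)
        assume "(b [^] t) \<odot>\<^bsub>M\<^esub> s \<notin> N'"
        then obtain n c where n: "n \<in> N'" "c \<in> carrier R" "x = n \<oplus>\<^bsub>M\<^esub> c \<odot>\<^bsub>M\<^esub> ((b [^] t) \<odot>\<^bsub>M\<^esub> s)"
          using max[of "(b [^] t) \<odot>\<^bsub>M\<^esub> s"] bR s by auto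
        have y: "c \<odot>\<^bsub>M\<^esub> ((b [^] t) \<odot>\<^bsub>M\<^esub> s) \<in> carrier M" using n bR s by simp
        \<comment> \<open>Multiplying the expression for \<open>x\<close> by \<open>b\<close> and
          using \<open>b x \<in> N'\<close> puts \<open>c\<close> into \<open>J (Suc t)\<close>,
          hence into \<open>J t\<close>; then both summands of \<open>x\<close> lie in
          \<open>N'\<close>.\<close>
        have "b \<odot>\<^bsub>M\<^esub> n \<oplus>\<^bsub>M\<^esub> b \<odot>\<^bsub>M\<^esub> (c \<odot>\<^bsub>M\<^esub> ((b [^] t) \<odot>\<^bsub>M\<^esub> s)) = b \<odot>\<^bsub>M\<^esub> x"
          using n(3) y bR carr[OF n(1)] smult_r_distr[of b n] by simp
        then have "b \<odot>\<^bsub>M\<^esub> (c \<odot>\<^bsub>M\<^esub> ((b [^] t) \<odot>\<^bsub>M\<^esub> s)) \<in> N'"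
          using submodule_add_cancel[OF N'(1), of "b \<odot>\<^bsub>M\<^esub> n"] bx[OF b] bR y
            submoduleE(4)[OF N'(1) bR n(1)] by simp
        then have "c \<in> J (Suc t)" using n(2) step by (simp add: J_def)
        then have "c \<in> J t" using t by blast
        then show False
          using n N'(3) submodule_add[OF N'(1)] by (auto simp: J_def)
      qed
      then show ?thesis by blast
    qed
    then have "\<forall>s\<in>S. \<exists>t::nat. (b [^] t) \<odot>\<^bsub>M\<^esub> s \<in> N'" using S(2) by blast
    then obtain t :: "'c \<Rightarrow> nat" where t: "\<And>s. s \<in> S \<Longrightarrow> (b [^] t s) \<odot>\<^bsub>M\<^esub> s \<in> N'" by metis
    \<comment> \<open>The sum of the exponents over the finite generating set bounds each of them,
      so one power of \<open>b\<close> works for all generators.\<close>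
    have "(b [^] sum t S) \<odot>\<^bsub>M\<^esub> y \<in> N'" if "y \<in> carrier M" for y
    proof (rule residual_generators[OF N'(1) S(2,3) _ _ that])
      fix s assume s: "s \<in> S"
      then have "sum t S = (sum t S - t s) + t s"
        using S(1) by (simp add: member_le_sum)
      then have "b [^] sum t S = b [^] (sum t S - t s) \<otimes> b [^] t s"
        using bR R.nat_pow_mult by metis
      then show "(b [^] sum t S) \<odot>\<^bsub>M\<^esub> s \<in> N'"
        using t[OF s] bR s S(2) submoduleE(4)[OF N'(1)] by (auto simp: smult_assoc1)
    qed (use bR in simp)
    then show "\<exists>t::nat. \<forall>y\<in>carrier M. (b [^] t) \<odot>\<^bsub>M\<^esub> y \<in> N'" by blast
  qed
qed

end

section \<open>Powers of an ideal, and the colon condition for absolutely superficial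
  sequences\<close>

lemma (in cring) ideal_colon:
  assumes "ideal I R" "b \<in> carrier R"
  shows "ideal {c \<in> carrier R. c \<otimes> b \<in> I} R"
proof (rule idealI[OF ring_axioms])
  interpret I: ideal I R by fact
  show "subgroup {c \<in> carrier R. c \<otimes> b \<in> I} (add_monoid R)"
    by (rule add.subgroupI) (use assms(2) in \<open>auto simp: l_distr l_minus\<close>)
  show "d \<otimes> c \<in> {c \<in> carrier R. c \<otimes> b \<in> I}"
    if "c \<in> {c \<in> carrier R. c \<otimes> b \<in> I}" "d \<in> carrier R" for c d
    using that assms(2) I.I_l_closed by (auto simp: m_assoc)
  then show "c \<otimes> d \<in> {c \<in> carrier R. c \<otimes> b \<in> I}"
    if "c \<in> {c \<in> carrier R. c \<otimes> b \<in> I}" "d \<in> carrier R" for c d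
    using that m_comm[of c d] by simp
qed

lemma (in cring) seq_ideal_ideal:
  "(\<And>i. i \<in> {1..k} \<Longrightarrow> a i \<in> carrier R) \<Longrightarrow> ideal (seq_ideal R a k) R"
  unfolding seq_ideal_def by (rule genideal_ideal) auto

lemma (in cring) ideal_pow_ideal:
  "ideal I R \<Longrightarrow> ideal (ideal_pow R I n) R"
  by (induction n) (auto simp: ideal_pow_def ideals_set_def oneideal ideal_prod_is_ideal)

text \<open>Induction on the exponent: if \<open>J\<close> contains the given powers of the generators, then
  each colon ideal \<open>J : a\<^sub>i\<close> contains the same powers with the \<open>i\<close>-th exponent lowered by one.\<close>

lemma (in cring) ideal_pow_subset:
  assumes a: "\<And>i. i \<in> {1..r} \<Longrightarrow> a i \<in> carrier R" and r: "r \<ge> 1"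
  shows "ideal J R \<Longrightarrow> (\<And>i. i \<in> {1..r} \<Longrightarrow> a i [^] (e i :: nat) \<in> J) \<Longrightarrow> sum e {1..r} \<le> n
    \<Longrightarrow> ideal_pow R (seq_ideal R a r) n \<subseteq> J"
proof (induction n arbitrary: J e)
  case 0
  \<comment> \<open>Since \<open>r \<ge> 1\<close>, the index 1 exists, and its exponent 0 makes
    \<open>1\<close> one of the powers contained in \<open>J\<close>.\<close>
  then have "e 1 = 0" using r by simp
  then have "\<one> \<in> J" using 0(2)[of 1] r by simp
  then show ?case
    using ideal.one_imp_carrier[OF 0(1)] by (simp add: ideal_pow_def ideals_set_def)
next
  case (Suc n)
  let ?q = "seq_ideal R a r"
  have q: "ideal ?q R" by (rule seq_ideal_ideal[OF a])
  have qn: "ideal (ideal_pow R ?q n) R" by (rule ideal_pow_ideal[OF q])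
  show ?case
  \<comment> \<open>A zero exponent makes \<open>J\<close> the unit ideal. Otherwise
    \<open>e i - 1\<close> is a true predecessor, and lowering one exponent lowers the sum by
    one.\<close>
  proof (cases "\<exists>i\<in>{1..r}. e i = 0")
    case True
    then have "\<one> \<in> J" using Suc.prems(2) by fastforce
    then show ?thesis
      using ideal.one_imp_carrier[OF Suc.prems(1)] ideal.Icarr[OF ideal_pow_ideal[OF q]] by blast
  next
    case False
    have J: "\<And>c d. c \<in> carrier R \<Longrightarrow> d \<in> J \<Longrightarrow> c \<otimes> d \<in> J"
      "\<And>c d. c \<in> carrier R \<Longrightarrow> d \<in> J \<Longrightarrow> d \<otimes> c \<in> J"
      "\<And>c. c \<in> J \<Longrightarrow> c \<in> carrier R"
      using ideal.I_l_closed[OF Suc.prems(1)] ideal.I_r_closed[OF Suc.prems(1)]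
        ideal.Icarr[OF Suc.prems(1)] by blast+
    have gen: "ideal_pow R ?q n \<subseteq> {c \<in> carrier R. c \<otimes> a i \<in> J}" if i: "i \<in> {1..r}" for i
    proof (rule Suc.IH)
      show "ideal {c \<in> carrier R. c \<otimes> a i \<in> J} R"
        using ideal_colon[OF Suc.prems(1)] a i by auto
      show "a j [^] (e(i := e i - 1)) j \<in> {c \<in> carrier R. c \<otimes> a i \<in> J}" if "j \<in> {1..r}" for j
      proof (cases "j = i")
        case True
        have "a i [^] (e i - 1) \<otimes> a i = a i [^] e i"
          using False i nat_pow_Suc[of "a i" "e i - 1"] by (simp add: Suc_diff_le)
        then show ?thesis using True i a Suc.prems(2) by auto
      qed (use that i a Suc.prems(2) J in auto)
      have "sum e {1..r} = e i + sum e ({1..r} - {i})"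
        using i by (subst sum.remove[of _ i]) auto
      moreover have "sum (e(i := e i - 1)) {1..r} = (e i - 1) + sum e ({1..r} - {i})"
        using i by (subst sum.remove[of _ i]) auto
      moreover have "e i \<noteq> 0" using False i by auto
      ultimately show "sum (e(i := e i - 1)) {1..r} \<le> n" using Suc.prems(3) by linarith
    qed
    \<comment> \<open>By \<open>gen\<close> and commutativity, the ideal \<open>J : c\<close>
      contains all generators \<open>a i\<close>, hence all of \<open>\<qq>\<close>.\<close>
    have prod: "c \<otimes> d \<in> J" if c: "c \<in> ideal_pow R ?q n" and d: "d \<in> ?q" for c d
    proof -
      have cR: "c \<in> carrier R" using c ideal.Icarr[OF qn] by blast
      have "?q \<subseteq> {d \<in> carrier R. d \<otimes> c \<in> J}"
        unfolding seq_ideal_def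
      proof (rule genideal_minimal[OF ideal_colon[OF Suc.prems(1) cR]])
        show "a ` {1..r} \<subseteq> {d \<in> carrier R. d \<otimes> c \<in> J}"
          using gen c cR a m_comm by fastforce
      qed
      then show ?thesis using d cR m_comm by fastforce
    qed
    have "s \<in> J" if "s \<in> ideal_prod R (ideal_pow R ?q n) ?q" for s
      using that
      by (induction s rule: ideal_prod.induct)
        (auto intro: prod additive_subgroup.a_closed[OF ideal.axioms(1)[OF Suc.prems(1)]])
    then show ?thesis by (auto simp: ideal_pow_def ideals_set_def)
  qed
qed

text \<open>In \<open>M / \<qq>\<^sub>i\<^sub>-\<^sub>1 M\<close> an element of
  \<open>\<qq>M\<close> killed by \<open>a\<^sub>i\<close> lies in \<open>\<qq>\<^sup>nM\<close> for all large \<open>n\<close>, hence vanishes by Krull's theorem.\<close>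

lemma (in module) abs_superficial_colon:
  assumes loc: "local_ring R \<mm>" and fg: "fin_gen_module R M"
    and am: "\<And>i. i \<in> {1..r} \<Longrightarrow> a i \<in> \<mm>" and sup: "abs_superficial R M r a"
    and i: "i \<in> {1..r}" and x: "x \<in> ideal_smult R (seq_ideal R a r) M"
    and ax: "a i \<odot>\<^bsub>M\<^esub> x \<in> ideal_smult R (seq_ideal R a (i - 1)) M"
  shows "x \<in> ideal_smult R (seq_ideal R a (i - 1)) M"
proof (rule ccontr)
  define N where "N = ideal_smult R (seq_ideal R a (i - 1)) M"
  define M' where "M' = quot_module M N"
  define q where "q = seq_ideal R a r"
  assume "x \<notin> ideal_smult R (seq_ideal R a (i - 1)) M"
  then have xN: "x \<notin> N" by (simp add: N_def)
  have "ideal \<mm> R" using loc maximalideal.axioms(1) unfolding local_ring_def by blast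
  then have aR: "a j \<in> carrier R" if "j \<in> {1..r}" for j
    using am[OF that] ideal.Icarr by metis
  have q: "ideal q R" unfolding q_def by (rule R.seq_ideal_ideal[OF aR])
  have qR: "q \<subseteq> carrier R" using ideal.Icarr[OF q] by blast
  have qpow: "ideal_pow R q n \<subseteq> carrier R" for n
    using ideal.Icarr[OF R.ideal_pow_ideal[OF q]] by blast
  have "ideal (seq_ideal R a (i - 1)) R"
    using aR i by (intro R.seq_ideal_ideal) auto
  then have N: "submodule N R M"
    unfolding N_def by (intro ideal_smult_submodule) (auto dest: ideal.Icarr)
  interpret Q: module R M' unfolding M'_def by (rule quot_is_module[OF N])
  have xM: "x \<in> carrier M"
    using subsetD[OF submodule_carrier[OF ideal_smult_submodule[OF qR]]] x by (simp add: q_def)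
  \<comment> \<open>Krull's theorem enters as a separation of \<open>x\<close> from
    \<open>N\<close>: some power of each element of \<open>\<mm>\<close> maps \<open>M\<close> into
    \<open>N'\<close>, although \<open>x\<close> stays outside.\<close>
  obtain N' where N': "submodule N' R M" "N \<subseteq> N'" "x \<notin> N'"
    and pow: "\<And>b. b \<in> \<mm> \<Longrightarrow> \<exists>t::nat. \<forall>y\<in>carrier M. (b [^] t) \<odot>\<^bsub>M\<^esub> y \<in> N'"
    using krull_separation[OF loc fg N xM xN] by metis
  have "\<forall>j\<in>{1..r}. \<exists>t::nat. \<forall>y\<in>carrier M. (a j [^] t) \<odot>\<^bsub>M\<^esub> y \<in> N'"
    using pow am by blast
  then obtain e :: "nat \<Rightarrow> nat"
    where e: "\<And>j y. j \<in> {1..r} \<Longrightarrow> y \<in> carrier M \<Longrightarrow> (a j [^] e j) \<odot>\<^bsub>M\<^esub> y \<in> N'" by metis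
  define J where "J = {c \<in> carrier R. \<forall>y\<in>carrier M. c \<odot>\<^bsub>M\<^esub> y \<in> N'}"
  have J: "ideal J R" unfolding J_def by (rule ideal_residual[OF N'(1)]) simp
  \<comment> \<open>\<open>J\<close> is the ideal of scalars taking \<open>M\<close> into
    \<open>N'\<close>. It contains a power of each \<open>a j\<close>, hence every power of
    \<open>\<qq>\<close> whose exponent is at least the sum of the \<open>e j\<close>.\<close>
  have qJ: "ideal_pow R q n \<subseteq> J" if "n \<ge> sum e {1..r}" for n
    unfolding q_def
    by (rule R.ideal_pow_subset[where e = e]) (use aR i that J e in \<open>auto simp: J_def\<close>)
  obtain n\<^sub>0 where "\<forall>n\<ge>n\<^sub>0. colon M' (ideal_smult R (ideal_pow R q (n + 1)) M') (a i) \<inter> ideal_smult R q M'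
      = ideal_smult R (ideal_pow R q n) M'"
    using bspec[OF sup[unfolded abs_superficial_def] i]
    unfolding seq_quot_def Let_def M'_def N_def q_def by (rule exE)
  \<comment> \<open>The maximum of \<open>n\<^sub>0\<close> and the sum of the exponents serves both
    purposes.\<close>
  then obtain n where n: "n \<ge> sum e {1..r}" and
    eq: "colon M' (ideal_smult R (ideal_pow R q (n + 1)) M') (a i) \<inter> ideal_smult R q M'
      = ideal_smult R (ideal_pow R q n) M'"
    by (meson max.cobounded1 max.cobounded2)
  have "N +>\<^bsub>M\<^esub> x \<in> ideal_smult R q M'"
    unfolding M'_def using x by (intro coset_in_ideal_smult_quot N qR) (simp add: q_def)
  \<comment> \<open>In the quotient \<open>a i\<close> kills the coset of \<open>x\<close>, and zero
    lies in every submodule, in particular in that of the power \<open>n + 1\<close>.\<close>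
  moreover have "N +>\<^bsub>M\<^esub> x \<in> colon M' (ideal_smult R (ideal_pow R q (n + 1)) M') (a i)"
  proof -
    have "a i \<odot>\<^bsub>M'\<^esub> (N +>\<^bsub>M\<^esub> x) = \<zero>\<^bsub>M'\<^esub>"
      using ax[folded N_def] aR[OF i] xM coset_eq_iff[OF N, of "a i \<odot>\<^bsub>M\<^esub> x"]
      by (simp add: M'_def quot_smult'[OF N])
    then show ?thesis
      using submodule_zero[OF Q.ideal_smult_submodule[OF qpow]] xM
      by (auto simp: colon_def M'_def quot_carrier_iff)
  qed
  ultimately have "N +>\<^bsub>M\<^esub> x \<in> ideal_smult R (ideal_pow R q n) (quot_module M N)"
    using eq by (auto simp: M'_def)
  from in_submodule_of_coset_in_ideal_smult_quot[OF N N'(1,2) qpow _ xM this]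
  have "x \<in> N'" using qJ[OF n] by (auto simp: J_def)
  then show False using N'(3) by simp
qed

section \<open>Polynomials with coefficients in a module\<close>

text \<open>A submultiset of \<open>add_mset x m\<close> either arises by adding \<open>x\<close> to
  a submultiset of \<open>m\<close>, or is itself one. Coefficients of products are sums over this
  set.\<close>

lemma finite_submultisets: "finite {k. k \<subseteq># m}"
proof (induction m)
  case (add x m)
  have "k \<in> {k. k \<subseteq># m} \<union> add_mset x ` {k. k \<subseteq># m}" if "k \<subseteq># add_mset x m" for k
  proof (cases "x \<in># k")
    case True
    then have "k = add_mset x (k - {#x#})" by simp
    moreover have "k - {#x#} \<subseteq># m" using that by (simp add: subset_eq_diff_conv)
    ultimately show ?thesis by blast
  next
    case False
    have "count k y \<le> count m y" for y
      using that False mset_subset_eq_count[OF that, of y]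
      by (cases "y = x") (auto simp: not_in_iff)
    then show ?thesis by (simp add: subseteq_mset_def)
  qed
  then have "{k. k \<subseteq># add_mset x m} \<subseteq> {k. k \<subseteq># m} \<union> add_mset x ` {k. k \<subseteq># m}" by blast
  then show ?case by (rule finite_subset) (use add in auto)
qed simp

text \<open>Multiplication by \<open>X\<^sub>i\<close>, described on coefficients to avoid
  convolution sums; the proof of \<open>Xmul_in_submodule\<close> identifies it with the action of
  the polynomial \<open>X\<^sub>i\<close>.\<close>

definition Xmul :: "('a, 'b, 'y) module_scheme \<Rightarrow> nat \<Rightarrow> (nat multiset \<Rightarrow> 'b) \<Rightarrow> nat multiset \<Rightarrow> 'b" where
  "Xmul M i f = (\<lambda>m. if i \<in># m then f (m - {#i#}) else \<zero>\<^bsub>M\<^esub>)"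

lemma mpoly_carrierD:
  assumes "f \<in> mpoly_carrier r M"
  shows "f m \<in> carrier M" "finite {m. f m \<noteq> \<zero>\<^bsub>M\<^esub>}" "f m \<noteq> \<zero>\<^bsub>M\<^esub> \<Longrightarrow> set_mset m \<subseteq> {1..r}"
  using assms by (auto simp: mpoly_carrier_def)

lemma formsD:
  assumes "f \<in> forms r M d"
  shows "f \<in> mpoly_carrier r M" "f m \<noteq> \<zero>\<^bsub>M\<^esub> \<Longrightarrow> size m = d"
  using assms by (auto simp: forms_def)

lemma mpoly_module_simps [simp]:
  "carrier (mpoly_module r M) = mpoly_carrier r M"
  "\<zero>\<^bsub>mpoly_module r M\<^esub> = (\<lambda>m. \<zero>\<^bsub>M\<^esub>)"
  "f \<oplus>\<^bsub>mpoly_module r M\<^esub> g = (\<lambda>m. f m \<oplus>\<^bsub>M\<^esub> g m)"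
  "carrier (mpoly_ring r A) = mpoly_carrier r A"
  by (auto simp: mpoly_module_def mpoly_ring_def)

context module
begin

lemma mpoly_add_closed:
  assumes "f \<in> mpoly_carrier r M" "g \<in> mpoly_carrier r M"
  shows "(\<lambda>m. f m \<oplus>\<^bsub>M\<^esub> g m) \<in> mpoly_carrier r M"
proof -
  note f = mpoly_carrierD[OF assms(1)] and g = mpoly_carrierD[OF assms(2)]
  have *: "f m \<noteq> \<zero>\<^bsub>M\<^esub> \<or> g m \<noteq> \<zero>\<^bsub>M\<^esub>" if "f m \<oplus>\<^bsub>M\<^esub> g m \<noteq> \<zero>\<^bsub>M\<^esub>" for m
    using that by auto
  then have "{m. f m \<oplus>\<^bsub>M\<^esub> g m \<noteq> \<zero>\<^bsub>M\<^esub>} \<subseteq> {m. f m \<noteq> \<zero>\<^bsub>M\<^esub>} \<union> {m. g m \<noteq> \<zero>\<^bsub>M\<^esub>}" by blast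
  then have "finite {m. f m \<oplus>\<^bsub>M\<^esub> g m \<noteq> \<zero>\<^bsub>M\<^esub>}"
    by (rule finite_subset) (use f(2) g(2) in blast)
  moreover have "set_mset m \<subseteq> {1..r}" if "f m \<oplus>\<^bsub>M\<^esub> g m \<noteq> \<zero>\<^bsub>M\<^esub>" for m
    using *[OF that] f(3)[of m] g(3)[of m] by blast
  ultimately show ?thesis
    unfolding mpoly_carrier_def using f(1) g(1) by simp
qed

lemma mpoly_mono_support:
  assumes "f \<in> mpoly_carrier r M" "\<And>m. g m \<in> carrier M"
    and *: "\<And>m. g m \<noteq> \<zero>\<^bsub>M\<^esub> \<Longrightarrow> f m \<noteq> \<zero>\<^bsub>M\<^esub>"
  shows "g \<in> mpoly_carrier r M"
proof -
  have "{m. g m \<noteq> \<zero>\<^bsub>M\<^esub>} \<subseteq> {m. f m \<noteq> \<zero>\<^bsub>M\<^esub>}" using * by blast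
  then have "finite {m. g m \<noteq> \<zero>\<^bsub>M\<^esub>}"
    by (rule finite_subset) (rule mpoly_carrierD(2)[OF assms(1)])
  then show ?thesis
    using assms(2) mpoly_carrierD(3)[OF assms(1)] * unfolding mpoly_carrier_def by blast
qed

lemma mpoly_zero_closed: "(\<lambda>m. \<zero>\<^bsub>M\<^esub>) \<in> mpoly_carrier r M"
  by (auto simp: mpoly_carrier_def)

lemma mpoly_neg_closed:
  assumes "f \<in> mpoly_carrier r M"
  shows "(\<lambda>m. \<ominus>\<^bsub>M\<^esub> f m) \<in> mpoly_carrier r M"
  by (rule mpoly_mono_support[OF assms]) (use mpoly_carrierD(1)[OF assms] in auto)

lemma mpoly_module_abelian_group: "abelian_group (mpoly_module r M)"
proof (rule abelian_groupI)
  fix f assume f: "f \<in> carrier (mpoly_module r M)"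
  then show "\<exists>g\<in>carrier (mpoly_module r M). g \<oplus>\<^bsub>mpoly_module r M\<^esub> f = \<zero>\<^bsub>mpoly_module r M\<^esub>"
    by (intro bexI[of _ "\<lambda>m. \<ominus>\<^bsub>M\<^esub> f m"])
      (auto simp: mpoly_neg_closed mpoly_carrierD(1) M.l_neg)
qed (auto simp: mpoly_add_closed mpoly_zero_closed mpoly_carrierD(1) M.a_ac)

lemma mpoly_smult_eq:
  "p \<odot>\<^bsub>mpoly_module r M\<^esub> f = (\<lambda>m. \<Oplus>\<^bsub>M\<^esub>k\<in>{k. k \<subseteq># m}. p k \<odot>\<^bsub>M\<^esub> f (m - k))"
  by (simp add: mpoly_module_def)

lemma mpoly_smult_closed:
  assumes "p \<in> mpoly_carrier r R" "f \<in> mpoly_carrier r M"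
  shows "p \<odot>\<^bsub>mpoly_module r M\<^esub> f \<in> mpoly_carrier r M"
proof -
  note p = mpoly_carrierD[OF assms(1)] and f = mpoly_carrierD[OF assms(2)]
  let ?g = "p \<odot>\<^bsub>mpoly_module r M\<^esub> f"
  \<comment> \<open>A nonzero coefficient at \<open>m\<close> comes from a splitting of
    \<open>m\<close> into monomials of the two supports. This gives both finiteness and the bound on
    the variables.\<close>
  have supp: "\<exists>k. k \<subseteq># m \<and> p k \<noteq> \<zero> \<and> f (m - k) \<noteq> \<zero>\<^bsub>M\<^esub>" if "?g m \<noteq> \<zero>\<^bsub>M\<^esub>" for m
  proof (rule ccontr)
    assume "\<nexists>k. k \<subseteq># m \<and> p k \<noteq> \<zero> \<and> f (m - k) \<noteq> \<zero>\<^bsub>M\<^esub>"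
    then have "p k \<odot>\<^bsub>M\<^esub> f (m - k) = \<zero>\<^bsub>M\<^esub>" if "k \<in> {k. k \<subseteq># m}" for k
      using that p(1)[of k] f(1)[of "m - k"] by (cases "p k = \<zero>") auto
    then have "?g m = \<zero>\<^bsub>M\<^esub>" unfolding mpoly_smult_eq by (rule M.add.finprod_one_eqI)
    then show False using that by simp
  qed
  have "{m. ?g m \<noteq> \<zero>\<^bsub>M\<^esub>} \<subseteq> (\<lambda>(k, l). k + l) ` ({k. p k \<noteq> \<zero>} \<times> {l. f l \<noteq> \<zero>\<^bsub>M\<^esub>})"
  proof
    fix m assume "m \<in> {m. ?g m \<noteq> \<zero>\<^bsub>M\<^esub>}"
    then obtain k where "k \<subseteq># m" "p k \<noteq> \<zero>" "f (m - k) \<noteq> \<zero>\<^bsub>M\<^esub>" using supp by blast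
    then show "m \<in> (\<lambda>(k, l). k + l) ` ({k. p k \<noteq> \<zero>} \<times> {l. f l \<noteq> \<zero>\<^bsub>M\<^esub>})"
      by (intro image_eqI[of _ _ "(k, m - k)"]) auto
  qed
  then have "finite {m. ?g m \<noteq> \<zero>\<^bsub>M\<^esub>}"
    by (rule finite_subset) (use p(2) f(2) in blast)
  moreover have "set_mset m \<subseteq> {1..r}" if g: "?g m \<noteq> \<zero>\<^bsub>M\<^esub>" for m
  proof -
    obtain k where k: "k \<subseteq># m" "p k \<noteq> \<zero>" "f (m - k) \<noteq> \<zero>\<^bsub>M\<^esub>" using supp[OF g] by blast
    then have "m = k + (m - k)" by simp
    then have "set_mset m = set_mset k \<union> set_mset (m - k)" by (metis set_mset_union)
    then show ?thesis using p(3)[OF k(2)] f(3)[OF k(3)] by blast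
  qed
  moreover have "?g m \<in> carrier M" for m
    unfolding mpoly_smult_eq using p(1) f(1) by (intro M.finsum_closed) auto
  ultimately show ?thesis unfolding mpoly_carrier_def by blast
qed

lemma mpoly_smult_r_distr:
  assumes "p \<in> mpoly_carrier r R" "f \<in> mpoly_carrier r M" "g \<in> mpoly_carrier r M"
  shows "p \<odot>\<^bsub>mpoly_module r M\<^esub> (f \<oplus>\<^bsub>mpoly_module r M\<^esub> g)
    = p \<odot>\<^bsub>mpoly_module r M\<^esub> f \<oplus>\<^bsub>mpoly_module r M\<^esub> p \<odot>\<^bsub>mpoly_module r M\<^esub> g"
proof
  fix m
  note carr = mpoly_carrierD(1)[OF assms(1)] mpoly_carrierD(1)[OF assms(2)]
    mpoly_carrierD(1)[OF assms(3)]
  show "(p \<odot>\<^bsub>mpoly_module r M\<^esub> (f \<oplus>\<^bsub>mpoly_module r M\<^esub> g)) m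
    = (p \<odot>\<^bsub>mpoly_module r M\<^esub> f \<oplus>\<^bsub>mpoly_module r M\<^esub> p \<odot>\<^bsub>mpoly_module r M\<^esub> g) m"
    using carr by (simp add: mpoly_smult_eq smult_r_distr M.finsum_addf Pi_def)
qed

lemma Xmul_closed:
  assumes "f \<in> mpoly_carrier r M" "i \<in> {1..r}"
  shows "Xmul M i f \<in> mpoly_carrier r M"
proof -
  note f = mpoly_carrierD[OF assms(1)]
  have "{m. Xmul M i f m \<noteq> \<zero>\<^bsub>M\<^esub>} \<subseteq> add_mset i ` {m. f m \<noteq> \<zero>\<^bsub>M\<^esub>}"
  proof
    fix m assume "m \<in> {m. Xmul M i f m \<noteq> \<zero>\<^bsub>M\<^esub>}"
    then have "i \<in># m" "f (m - {#i#}) \<noteq> \<zero>\<^bsub>M\<^esub>" by (auto simp: Xmul_def split: if_splits)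
    then show "m \<in> add_mset i ` {m. f m \<noteq> \<zero>\<^bsub>M\<^esub>}"
      by (intro image_eqI[of _ _ "m - {#i#}"]) auto
  qed
  then have "finite {m. Xmul M i f m \<noteq> \<zero>\<^bsub>M\<^esub>}" by (rule finite_subset) (use f(2) in blast)
  moreover have "set_mset m \<subseteq> {1..r}" if "Xmul M i f m \<noteq> \<zero>\<^bsub>M\<^esub>" for m
  proof -
    have m: "i \<in># m" "f (m - {#i#}) \<noteq> \<zero>\<^bsub>M\<^esub>" using that by (auto simp: Xmul_def split: if_splits)
    then have "set_mset m = insert i (set_mset (m - {#i#}))"
      by (metis insert_DiffM set_mset_add_mset_insert)
    then show ?thesis using f(3)[OF m(2)] assms(2) by (metis insert_subset)
  qed
  ultimately show ?thesis unfolding mpoly_carrier_def Xmul_def using f(1) by simp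
qed

lemma Xmul_forms:
  assumes "f \<in> forms r M d" "i \<in> {1..r}"
  shows "Xmul M i f \<in> forms r M (Suc d)"
proof -
  have "size m = Suc d" if "Xmul M i f m \<noteq> \<zero>\<^bsub>M\<^esub>" for m
  proof -
    have m: "i \<in># m" "f (m - {#i#}) \<noteq> \<zero>\<^bsub>M\<^esub>" using that by (auto simp: Xmul_def split: if_splits)
    then show ?thesis using formsD(2)[OF assms(1) m(2)] by (metis size_Suc_Diff1)
  qed
  then show ?thesis using Xmul_closed[OF formsD(1)[OF assms(1)] assms(2)] by (simp add: forms_def)
qed

text \<open>\<open>Xmul M i\<close> is the action of the polynomial \<open>?p\<close>: in the
  convolution at \<open>m\<close> only the submultiset \<open>{#i#}\<close> contributes, and it is
  present exactly when \<open>i \<in># m\<close>.\<close>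

lemma Xmul_in_submodule:
  assumes L: "submodule L (mpoly_ring r R) (mpoly_module r M)" and f: "f \<in> L" and i: "i \<in> {1..r}"
  shows "Xmul M i f \<in> L"
proof -
  let ?p = "\<lambda>m. if m = {#i#} then \<one> else \<zero>"
  have fM: "f \<in> mpoly_carrier r M" using submodule_carrier[OF L] f by auto
  have "?p \<in> mpoly_carrier r R"
    using i by (auto simp: mpoly_carrier_def intro: finite_subset[of _ "{{#i#}}"])
  then have "?p \<odot>\<^bsub>mpoly_module r M\<^esub> f \<in> L"
    using submodule.smult_closed[OF L] f by simp
  moreover have "?p \<odot>\<^bsub>mpoly_module r M\<^esub> f = Xmul M i f"
  proof
    fix m
    have "(?p \<odot>\<^bsub>mpoly_module r M\<^esub> f) m
        = (\<Oplus>\<^bsub>M\<^esub>k\<in>{k. k \<subseteq># m}. if k = {#i#} then f (m - k) else \<zero>\<^bsub>M\<^esub>)"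
      unfolding mpoly_smult_eq using mpoly_carrierD(1)[OF fM] by (intro M.finsum_cong') auto
    also have "\<dots> = Xmul M i f m"
    proof (cases "i \<in># m")
      case True
      then show ?thesis
        using mpoly_carrierD(1)[OF fM] finite_submultisets
        by (subst M.add.finprod_singleton_swap) (auto simp: Xmul_def)
    next
      case False
      then show ?thesis
        by (auto simp: Xmul_def intro!: M.add.finprod_one_eqI)
    qed
    finally show "(?p \<odot>\<^bsub>mpoly_module r M\<^esub> f) m = Xmul M i f m" .
  qed
  ultimately show ?thesis by simp
qed

text \<open>Indices outside \<open>m\<close> contribute the zeroth power, which is 1. A common index
  set makes different monomials comparable.\<close>

lemma eval_monom_eq_finprod:
  assumes "finite S" "set_mset m \<subseteq> S" "\<And>i. i \<in> S \<Longrightarrow> a i \<in> carrier R"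
  shows "eval_monom R a m = (\<Otimes>i\<in>S. a i [^] count m i)"
  unfolding eval_monom_def
  by (rule R.finprod_mono_neutral_cong_left) (use assms in \<open>auto simp: not_in_iff\<close>)

lemma eval_monom_closed:
  "(\<And>i. i \<in># m \<Longrightarrow> a i \<in> carrier R) \<Longrightarrow> eval_monom R a m \<in> carrier R"
  unfolding eval_monom_def by (intro R.finprod_closed) auto

lemma eval_monom_empty [simp]: "eval_monom R a {#} = \<one>"
  by (simp add: eval_monom_def)

lemma eval_monom_add_mset:
  assumes "\<And>j. j \<in># add_mset i m \<Longrightarrow> a j \<in> carrier R"
  shows "eval_monom R a (add_mset i m) = a i \<otimes> eval_monom R a m"
proof -
  \<comment> \<open>Splitting off \<open>i\<close> covers both cases, \<open>i\<close> in
    \<open>m\<close> or not; over \<open>insert i ?T\<close> the two products differ only in the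
    exponent of \<open>a i\<close>.\<close>
  let ?T = "set_mset m - {i}"
  have T: "set_mset (add_mset i m) = insert i ?T" "set_mset m \<subseteq> insert i ?T" by auto
  have a: "a j \<in> carrier R" if "j \<in> insert i ?T" for j using assms that T by auto
  have "eval_monom R a (add_mset i m) = (\<Otimes>j\<in>insert i ?T. a j [^] count (add_mset i m) j)"
    by (rule eval_monom_eq_finprod) (use a in auto)
  also have "\<dots> = a i [^] Suc (count m i) \<otimes> (\<Otimes>j\<in>?T. a j [^] count (add_mset i m) j)"
    using a by (subst R.finprod_insert) auto
  also have "(\<Otimes>j\<in>?T. a j [^] count (add_mset i m) j) = (\<Otimes>j\<in>?T. a j [^] count m j)"
    using a by (intro R.finprod_cong') auto
  also have "a i [^] Suc (count m i) \<otimes> (\<Otimes>j\<in>?T. a j [^] count m j)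
      = a i \<otimes> (a i [^] count m i \<otimes> (\<Otimes>j\<in>?T. a j [^] count m j))"
    using a by (simp add: R.m_ac Pi_def)
  also have "a i [^] count m i \<otimes> (\<Otimes>j\<in>?T. a j [^] count m j) = (\<Otimes>j\<in>insert i ?T. a j [^] count m j)"
    using a by (subst R.finprod_insert) auto
  also have "\<dots> = eval_monom R a m"
    by (rule eval_monom_eq_finprod[symmetric]) (use a in auto)
  finally show ?thesis .
qed

end

section \<open>Evaluation of polynomials at the sequence\<close>

locale eval_setup = module +
  fixes r :: nat and a :: "nat \<Rightarrow> 'a"
  assumes a_closed: "\<And>i. i \<in> {1..r} \<Longrightarrow> a i \<in> carrier R"
begin

abbreviation "ev \<equiv> eval_mpoly R M a"

text \<open>Enlarging the index set adds only zero terms, so evaluations of different polynomials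
  can be summed over one set. The last condition on \<open>F\<close> keeps the monomial values in
  \<open>R\<close>.\<close>

lemma eval_eq_finsum:
  assumes f: "f \<in> mpoly_carrier r M" and F: "finite F" "{m. f m \<noteq> \<zero>\<^bsub>M\<^esub>} \<subseteq> F"
    "\<And>m. m \<in> F \<Longrightarrow> set_mset m \<subseteq> {1..r}"
  shows "ev f = (\<Oplus>\<^bsub>M\<^esub>m\<in>F. eval_monom R a m \<odot>\<^bsub>M\<^esub> f m)"
proof -
  have e: "eval_monom R a m \<in> carrier R" if "m \<in> F" for m
    using F(3)[OF that] a_closed by (intro eval_monom_closed) auto
  show ?thesis
    unfolding eval_mpoly_def
    by (rule M.add.finprod_mono_neutral_cong_left)
      (use F e mpoly_carrierD(1)[OF f] in auto)
qed

lemma eval_term_closed: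
  assumes "f \<in> mpoly_carrier r M" "f m \<noteq> \<zero>\<^bsub>M\<^esub>"
  shows "eval_monom R a m \<in> carrier R"
  using mpoly_carrierD(3)[OF assms] a_closed by (intro eval_monom_closed) auto

lemma eval_closed:
  assumes "f \<in> mpoly_carrier r M"
  shows "ev f \<in> carrier M"
  unfolding eval_mpoly_def
  using eval_term_closed[OF assms] mpoly_carrierD(1)[OF assms] by (intro M.finsum_closed) auto

lemma eval_add:
  assumes "f \<in> mpoly_carrier r M" "g \<in> mpoly_carrier r M"
  shows "ev (\<lambda>m. f m \<oplus>\<^bsub>M\<^esub> g m) = ev f \<oplus>\<^bsub>M\<^esub> ev g"
proof -
  note f = mpoly_carrierD[OF assms(1)] and g = mpoly_carrierD[OF assms(2)]
  let ?F = "{m. f m \<noteq> \<zero>\<^bsub>M\<^esub>} \<union> {m. g m \<noteq> \<zero>\<^bsub>M\<^esub>}"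
  have F: "finite ?F" "\<And>m. m \<in> ?F \<Longrightarrow> set_mset m \<subseteq> {1..r}" using f g by blast+
  have e: "eval_monom R a m \<in> carrier R" if "m \<in> ?F" for m
    using that eval_term_closed assms by blast
  have "ev (\<lambda>m. f m \<oplus>\<^bsub>M\<^esub> g m) = (\<Oplus>\<^bsub>M\<^esub>m\<in>?F. eval_monom R a m \<odot>\<^bsub>M\<^esub> (f m \<oplus>\<^bsub>M\<^esub> g m))"
    by (rule eval_eq_finsum[OF mpoly_add_closed[OF assms] F(1) _ F(2)]) auto
  also have "\<dots> = (\<Oplus>\<^bsub>M\<^esub>m\<in>?F. eval_monom R a m \<odot>\<^bsub>M\<^esub> f m \<oplus>\<^bsub>M\<^esub> eval_monom R a m \<odot>\<^bsub>M\<^esub> g m)"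
    using e f(1) g(1) by (intro M.finsum_cong') (auto simp: smult_r_distr)
  also have "\<dots> = (\<Oplus>\<^bsub>M\<^esub>m\<in>?F. eval_monom R a m \<odot>\<^bsub>M\<^esub> f m) \<oplus>\<^bsub>M\<^esub> (\<Oplus>\<^bsub>M\<^esub>m\<in>?F. eval_monom R a m \<odot>\<^bsub>M\<^esub> g m)"
    using e f(1) g(1) by (intro M.finsum_addf) auto
  also have "(\<Oplus>\<^bsub>M\<^esub>m\<in>?F. eval_monom R a m \<odot>\<^bsub>M\<^esub> f m) = ev f"
    by (rule eval_eq_finsum[OF assms(1) F(1) _ F(2), symmetric]) auto
  also have "(\<Oplus>\<^bsub>M\<^esub>m\<in>?F. eval_monom R a m \<odot>\<^bsub>M\<^esub> g m) = ev g"
    by (rule eval_eq_finsum[OF assms(2) F(1) _ F(2), symmetric]) auto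
  finally show ?thesis .
qed

lemma eval_const_smult:
  assumes f: "f \<in> mpoly_carrier r M" and c: "c \<in> carrier R"
  shows "(\<lambda>m. c \<odot>\<^bsub>M\<^esub> f m) \<in> mpoly_carrier r M" "ev (\<lambda>m. c \<odot>\<^bsub>M\<^esub> f m) = c \<odot>\<^bsub>M\<^esub> ev f"
proof -
  note fD = mpoly_carrierD[OF f]
  let ?F = "{m. f m \<noteq> \<zero>\<^bsub>M\<^esub>}"
  show g: "(\<lambda>m. c \<odot>\<^bsub>M\<^esub> f m) \<in> mpoly_carrier r M"
    by (rule mpoly_mono_support[OF f]) (use c fD(1) in auto)
  have e: "eval_monom R a m \<in> carrier R" if "m \<in> ?F" for m
    using that eval_term_closed[OF f] by blast
  have "ev (\<lambda>m. c \<odot>\<^bsub>M\<^esub> f m) = (\<Oplus>\<^bsub>M\<^esub>m\<in>?F. eval_monom R a m \<odot>\<^bsub>M\<^esub> (c \<odot>\<^bsub>M\<^esub> f m))"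
    by (rule eval_eq_finsum[OF g]) (use c fD in auto)
  also have "\<dots> = (\<Oplus>\<^bsub>M\<^esub>m\<in>?F. c \<odot>\<^bsub>M\<^esub> (eval_monom R a m \<odot>\<^bsub>M\<^esub> f m))"
    using e fD(1) c by (intro M.finsum_cong') (auto simp: R.m_comm simp flip: smult_assoc1)
  also have "\<dots> = c \<odot>\<^bsub>M\<^esub> ev f"
    unfolding eval_mpoly_def using e fD c by (intro finsum_smult_ldistr[symmetric]) auto
  finally show "ev (\<lambda>m. c \<odot>\<^bsub>M\<^esub> f m) = c \<odot>\<^bsub>M\<^esub> ev f" .
qed

text \<open>The support of \<open>X\<^sub>i f\<close> lies in the image of that of \<open>f\<close>
  under the injective map \<open>add_mset i\<close>, along which the sum is reindexed.\<close>

lemma eval_Xmul: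
  assumes f: "f \<in> mpoly_carrier r M" and i: "i \<in> {1..r}"
  shows "ev (Xmul M i f) = a i \<odot>\<^bsub>M\<^esub> ev f"
proof -
  note fD = mpoly_carrierD[OF f]
  let ?F = "{m. f m \<noteq> \<zero>\<^bsub>M\<^esub>}"
  have e: "eval_monom R a m \<in> carrier R" if "m \<in> ?F" for m
    using that eval_term_closed[OF f] by blast
  have ai: "a i \<in> carrier R" by (rule a_closed[OF i])
  have em: "eval_monom R a (add_mset i m) = a i \<otimes> eval_monom R a m" if "m \<in> ?F" for m
    using that fD(3)[of m] i a_closed by (intro eval_monom_add_mset) auto
  have "ev (Xmul M i f) = (\<Oplus>\<^bsub>M\<^esub>m\<in>add_mset i ` ?F. eval_monom R a m \<odot>\<^bsub>M\<^esub> Xmul M i f m)"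
  proof (rule eval_eq_finsum[OF Xmul_closed[OF f i]])
    show "{m. Xmul M i f m \<noteq> \<zero>\<^bsub>M\<^esub>} \<subseteq> add_mset i ` ?F"
    proof
      fix m assume "m \<in> {m. Xmul M i f m \<noteq> \<zero>\<^bsub>M\<^esub>}"
      then have "i \<in># m" "f (m - {#i#}) \<noteq> \<zero>\<^bsub>M\<^esub>" by (auto simp: Xmul_def split: if_splits)
      then show "m \<in> add_mset i ` {m. f m \<noteq> \<zero>\<^bsub>M\<^esub>}"
        by (intro image_eqI[of _ _ "m - {#i#}"]) auto
    qed
    show "set_mset m \<subseteq> {1..r}" if mF: "m \<in> add_mset i ` ?F" for m
    proof -
      obtain l where "m = add_mset i l" "f l \<noteq> \<zero>\<^bsub>M\<^esub>" using mF by blast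
      then show ?thesis using fD(3)[of l] i by simp
    qed
  qed (use fD(2) in blast)
  also have "\<dots> = (\<Oplus>\<^bsub>M\<^esub>m\<in>?F. eval_monom R a (add_mset i m) \<odot>\<^bsub>M\<^esub> Xmul M i f (add_mset i m))"
    using em e ai fD(1) by (intro M.finsum_reindex) (auto simp: Xmul_def inj_on_def)
  also have "\<dots> = (\<Oplus>\<^bsub>M\<^esub>m\<in>?F. a i \<odot>\<^bsub>M\<^esub> (eval_monom R a m \<odot>\<^bsub>M\<^esub> f m))"
    using em e ai fD(1) by (intro M.finsum_cong') (auto simp: Xmul_def smult_assoc1)
  also have "\<dots> = a i \<odot>\<^bsub>M\<^esub> ev f"
    unfolding eval_mpoly_def using e fD ai by (intro finsum_smult_ldistr[symmetric]) auto
  finally show ?thesis .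
qed


section \<open>Forms and the submodules generated by initial segments of the sequence\<close>

lemma forms_add:
  assumes "f \<in> forms r M d" "g \<in> forms r M d"
  shows "(\<lambda>m. f m \<oplus>\<^bsub>M\<^esub> g m) \<in> forms r M d"
proof -
  have "f m \<noteq> \<zero>\<^bsub>M\<^esub> \<or> g m \<noteq> \<zero>\<^bsub>M\<^esub>" if "f m \<oplus>\<^bsub>M\<^esub> g m \<noteq> \<zero>\<^bsub>M\<^esub>" for m
    using that by auto
  then show ?thesis
    using assms mpoly_add_closed unfolding forms_def by blast
qed

lemma eval_zero: "ev (\<lambda>m. \<zero>\<^bsub>M\<^esub>) = \<zero>\<^bsub>M\<^esub>"
  by (simp add: eval_mpoly_def)

lemma seq_ideal_props:
  assumes "k \<le> r"
  shows "ideal (seq_ideal R a k) R" "seq_ideal R a k \<subseteq> carrier R"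
    "\<And>j. j \<in> {1..k} \<Longrightarrow> a j \<in> seq_ideal R a k"
proof -
  have a: "a ` {1..k} \<subseteq> carrier R" using a_closed assms by auto
  then show I: "ideal (seq_ideal R a k) R"
    unfolding seq_ideal_def by (rule R.genideal_ideal)
  show "seq_ideal R a k \<subseteq> carrier R" using ideal.Icarr[OF I] by blast
  show "a j \<in> seq_ideal R a k" if "j \<in> {1..k}" for j
    using R.genideal_self[OF a] that unfolding seq_ideal_def by blast
qed

text \<open>For \<open>f \<in> M[X]\<close>, this says that \<open>f \<in> (X\<^sub>1, \<dots>, X\<^sub>k)M[X]\<close>; the bound \<open>1 \<le> j\<close> comes from \<open>mpoly_carrier\<close>.\<close>

definition supp_upto :: "nat \<Rightarrow> (nat multiset \<Rightarrow> 'c) \<Rightarrow> bool" where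
  "supp_upto k f \<longleftrightarrow> (\<forall>m. f m \<noteq> \<zero>\<^bsub>M\<^esub> \<longrightarrow> (\<exists>j\<in>#m. j \<le> k))"

text \<open>A monomial of positive degree involves some variable, and all indices are at most
  \<open>r\<close>. This starts the descending induction at \<open>k = r\<close>.\<close>

lemma supp_upto_forms:
  assumes f: "f \<in> forms r M (Suc d)"
  shows "supp_upto r f"
  unfolding supp_upto_def
proof (intro allI impI)
  fix m assume m: "f m \<noteq> \<zero>\<^bsub>M\<^esub>"
  obtain j where "j \<in># m" using formsD(2)[OF f m] by (metis size_eq_Suc_imp_elem)
  moreover have "set_mset m \<subseteq> {1..r}" by (rule mpoly_carrierD(3)[OF formsD(1)[OF f] m])
  ultimately show "\<exists>j\<in>#m. j \<le> r" by (intro bexI[of _ j]) auto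
qed

text \<open>Each monomial in the support has a factor \<open>X\<^sub>j\<close> with
  \<open>j \<le> k\<close>, whose value \<open>a j\<close> lies in
  \<open>\<qq>\<^sub>k\<close>.\<close>

lemma eval_in_ideal_smult:
  assumes f: "f \<in> mpoly_carrier r M" and k: "k \<le> r" and supp: "supp_upto k f"
  shows "ev f \<in> ideal_smult R (seq_ideal R a k) M"
  unfolding eval_mpoly_def
proof (rule submodule_finsum[OF ideal_smult_submodule[OF seq_ideal_props(2)[OF k]]])
  fix m assume "m \<in> {m. f m \<noteq> \<zero>\<^bsub>M\<^esub>}"
  then have m: "f m \<noteq> \<zero>\<^bsub>M\<^esub>" by simp
  then obtain j where j: "j \<in># m" "j \<le> k" using supp by (auto simp: supp_upto_def)
  have mr: "set_mset m \<subseteq> {1..r}" by (rule mpoly_carrierD(3)[OF f m])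
  obtain l where l: "m = add_mset j l" using j(1) by (metis insert_DiffM)
  have aR: "a i \<in> carrier R" if "i \<in># add_mset j l" for i
    using that mr a_closed unfolding l by blast
  have "eval_monom R a m = a j \<otimes> eval_monom R a l"
    unfolding l by (rule eval_monom_add_mset) (rule aR)
  moreover have "j \<in> {1..k}" using j mr by auto
  then have "a j \<otimes> eval_monom R a l \<in> seq_ideal R a k"
    using seq_ideal_props[OF k] eval_monom_closed[of l a] aR
    by (intro ideal.I_r_closed) auto
  ultimately show "eval_monom R a m \<odot>\<^bsub>M\<^esub> f m \<in> ideal_smult R (seq_ideal R a k) M"
    using mpoly_carrierD(1)[OF f] by (simp add: smult_in_ideal_smult)
qed

text \<open>The values of linear forms in \<open>X\<^sub>1, \<dots>, X\<^sub>k\<close> make up a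
  submodule, and it contains each \<open>a j x\<close> as the value of
  \<open>x X\<^sub>j\<close>.\<close>

lemma ideal_smult_eq_eval_linear:
  assumes k: "k \<le> r" and y: "y \<in> ideal_smult R (seq_ideal R a k) M"
  obtains H where "H \<in> forms r M 1" "supp_upto k H" "ev H = y"
proof -
  let ?S = "{H \<in> forms r M 1. supp_upto k H}"
  have P: "submodule (ev ` ?S) R M"
  proof (rule submoduleI')
    show "ev ` ?S \<subseteq> carrier M" using eval_closed formsD(1) by blast
    show "\<zero>\<^bsub>M\<^esub> \<in> ev ` ?S"
      using eval_zero mpoly_zero_closed
      by (intro image_eqI[of _ _ "\<lambda>m. \<zero>\<^bsub>M\<^esub>"]) (auto simp: forms_def supp_upto_def)
    fix x z c assume "x \<in> ev ` ?S"
    then obtain F where F: "F \<in> forms r M 1" "supp_upto k F" "x = ev F" by blast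
    show "x \<oplus>\<^bsub>M\<^esub> z \<in> ev ` ?S" if z: "z \<in> ev ` ?S"
    proof -
      obtain G where G: "G \<in> forms r M 1" "supp_upto k G" "z = ev G" using z by blast
      have "F m \<noteq> \<zero>\<^bsub>M\<^esub> \<or> G m \<noteq> \<zero>\<^bsub>M\<^esub>" if "F m \<oplus>\<^bsub>M\<^esub> G m \<noteq> \<zero>\<^bsub>M\<^esub>" for m
        using that by auto
      then have "supp_upto k (\<lambda>m. F m \<oplus>\<^bsub>M\<^esub> G m)" using F(2) G(2) unfolding supp_upto_def by blast
      then show ?thesis
        using F(3) G(3) forms_add[OF F(1) G(1)] eval_add[OF formsD(1)[OF F(1)] formsD(1)[OF G(1)]]
        by (intro image_eqI[of _ _ "\<lambda>m. F m \<oplus>\<^bsub>M\<^esub> G m"]) auto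
    qed
    show "c \<odot>\<^bsub>M\<^esub> x \<in> ev ` ?S" if c: "c \<in> carrier R"
    proof (rule image_eqI)
      have "F m \<noteq> \<zero>\<^bsub>M\<^esub>" if "c \<odot>\<^bsub>M\<^esub> F m \<noteq> \<zero>\<^bsub>M\<^esub>" for m using that c by auto
      then show "(\<lambda>m. c \<odot>\<^bsub>M\<^esub> F m) \<in> ?S"
        using F(1,2) eval_const_smult(1)[OF formsD(1)[OF F(1)] c]
        unfolding supp_upto_def forms_def by blast
      show "c \<odot>\<^bsub>M\<^esub> x = ev (\<lambda>m. c \<odot>\<^bsub>M\<^esub> F m)"
        using eval_const_smult(2)[OF formsD(1)[OF F(1)] c] F(3) by simp
    qed
  qed
  have gen: "a j \<odot>\<^bsub>M\<^esub> x \<in> ev ` ?S" if j: "j \<in> {1..k}" and x: "x \<in> carrier M" for j x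
  proof (rule image_eqI)
    let ?H = "\<lambda>m. if m = {#j#} then x else \<zero>\<^bsub>M\<^esub>"
    have H: "?H \<in> mpoly_carrier r M"
      using j k x by (auto simp: mpoly_carrier_def intro: finite_subset[of _ "{{#j#}}"])
    then show "?H \<in> ?S" using j by (auto simp: forms_def supp_upto_def)
    have aj: "a j \<in> carrier R" using j k a_closed by auto
    have "ev ?H = (\<Oplus>\<^bsub>M\<^esub>m\<in>{{#j#}}. eval_monom R a m \<odot>\<^bsub>M\<^esub> ?H m)"
      by (rule eval_eq_finsum[OF H]) (use j k in auto)
    then show "a j \<odot>\<^bsub>M\<^esub> x = ev ?H"
      using eval_monom_add_mset[of j "{#}" a] aj x by simp
  qed
  \<comment> \<open>The scalars taking \<open>M\<close> into this submodule form an ideal; as it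
    contains \<open>a 1, \<dots>, a k\<close>, it contains \<open>\<qq>\<^sub>k\<close>.\<close>
  let ?I = "{c \<in> carrier R. \<forall>x\<in>carrier M. c \<odot>\<^bsub>M\<^esub> x \<in> ev ` ?S}"
  have "seq_ideal R a k \<subseteq> ?I"
    unfolding seq_ideal_def
    by (rule R.genideal_minimal[OF ideal_residual[OF P]]) (use gen a_closed k in auto)
  then have "ideal_smult R (seq_ideal R a k) M \<subseteq> ev ` ?S"
    by (intro ideal_smult_least[OF P]) blast
  then show thesis using y that by blast
qed

text \<open>The conclusion records more than a congruence modulo \<open>L\<close>: \<open>G\<close>
  is itself a form vanishing at \<open>a\<close>, so \<open>F\<close> and \<open>H\<close> have the
  same value, which the inner step relies on. Degrees are positive because a nonzero constant does
  not satisfy \<open>supp_upto r\<close>.\<close>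

lemma form_decomposition:
  assumes colon: "\<And>i x. i \<in> {1..r} \<Longrightarrow> x \<in> ideal_smult R (seq_ideal R a r) M \<Longrightarrow>
      a i \<odot>\<^bsub>M\<^esub> x \<in> ideal_smult R (seq_ideal R a (i - 1)) M \<Longrightarrow>
      x \<in> ideal_smult R (seq_ideal R a (i - 1)) M"
    and L: "submodule L (mpoly_ring r R) (mpoly_module r M)"
    and lin: "\<And>f. f \<in> forms r M 1 \<Longrightarrow> ev f = \<zero>\<^bsub>M\<^esub> \<Longrightarrow> f \<in> L"
  shows "F \<in> forms r M (Suc d) \<Longrightarrow> k \<le> r \<Longrightarrow> ev F \<in> ideal_smult R (seq_ideal R a k) M \<Longrightarrow>
    \<exists>G\<in>L. \<exists>H\<in>forms r M (Suc d). G \<in> forms r M (Suc d) \<and> ev G = \<zero>\<^bsub>M\<^esub> \<and> supp_upto k H \<and>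
      F = (\<lambda>m. G m \<oplus>\<^bsub>M\<^esub> H m)"
proof (induction d arbitrary: F k)
  case 0
  then obtain H where H: "H \<in> forms r M 1" "supp_upto k H" "ev H = ev F"
    using ideal_smult_eq_eval_linear by metis
  note F = formsD(1)[OF 0(1)] and Hc = formsD(1)[OF H(1)]
  \<comment> \<open>In degree one \<open>F - H\<close> vanishes at \<open>a\<close> and so lies in
    \<open>L\<close>. The negative is written as a scalar multiple to fit
    \<open>eval_const_smult\<close>.\<close>
  let ?N = "\<lambda>m. (\<ominus> \<one>) \<odot>\<^bsub>M\<^esub> H m"
  have N: "?N \<in> mpoly_carrier r M" "ev ?N = (\<ominus> \<one>) \<odot>\<^bsub>M\<^esub> ev H"
    using eval_const_smult[OF Hc] by auto
  have "H m \<noteq> \<zero>\<^bsub>M\<^esub>" if "?N m \<noteq> \<zero>\<^bsub>M\<^esub>" for m using that by auto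
  then have Nf: "?N \<in> forms r M 1" using N(1) H(1) unfolding forms_def by blast
  let ?G = "\<lambda>m. F m \<oplus>\<^bsub>M\<^esub> ?N m"
  have G: "?G \<in> forms r M 1" using forms_add Nf 0(1) by simp
  have evG: "ev ?G = \<zero>\<^bsub>M\<^esub>"
    using eval_add[OF F N(1)] N(2) H(3) eval_closed[OF F] by (simp add: smult_l_minus M.r_neg)
  have "F = (\<lambda>m. ?G m \<oplus>\<^bsub>M\<^esub> H m)"
    using mpoly_carrierD(1)[OF F] mpoly_carrierD(1)[OF Hc]
    by (simp add: smult_l_minus M.a_assoc M.l_neg)
  then show ?case using lin[OF G evG] G evG H(1,2) by (intro bexI[of _ ?G] bexI[of _ H]) auto
next
  case (Suc d)
  let ?D = "Suc (Suc d)"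
  let ?q = "\<lambda>k. ideal_smult R (seq_ideal R a k) M"
  let ?P = "\<lambda>k. \<forall>F\<in>forms r M ?D. ev F \<in> ?q k \<longrightarrow> (\<exists>G\<in>L. \<exists>H\<in>forms r M ?D. G \<in> forms r M ?D \<and>
    ev G = \<zero>\<^bsub>M\<^esub> \<and> supp_upto k H \<and> F = (\<lambda>m. G m \<oplus>\<^bsub>M\<^esub> H m))"
  \<comment> \<open>\<open>F\<close> is quantified inside \<open>?P\<close>, so the degree stays
    fixed while \<open>k\<close> descends from \<open>r\<close>; the outer hypothesis remains
    available for every \<open>k\<close> in the preceding degree.\<close>
  have "?P k"
    using Suc.prems(2)
  proof (induction k rule: inc_induct)
    case base
    show ?case
    proof (intro ballI impI)
      fix F assume F: "F \<in> forms r M ?D"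
      let ?Z = "\<lambda>m. \<zero>\<^bsub>M\<^esub>"
      have "F = (\<lambda>m. ?Z m \<oplus>\<^bsub>M\<^esub> F m)"
        using mpoly_carrierD(1)[OF formsD(1)[OF F]] by simp
      moreover have "?Z \<in> L" using submodule_zero[OF L] by simp
      moreover have "?Z \<in> forms r M ?D"
        using mpoly_zero_closed by (simp add: forms_def)
      ultimately show "\<exists>G\<in>L. \<exists>H\<in>forms r M ?D. G \<in> forms r M ?D \<and>
          ev G = \<zero>\<^bsub>M\<^esub> \<and> supp_upto r H \<and> F = (\<lambda>m. G m \<oplus>\<^bsub>M\<^esub> H m)"
        using F eval_zero supp_upto_forms[OF F] by blast
    qed
  next
    case (step n)
    let ?i = "Suc n"
    have i: "?i \<in> {1..r}" "n \<le> r" using step.hyps by auto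
    show ?case
    proof (intro ballI impI)
      fix F assume F: "F \<in> forms r M ?D" and evF: "ev F \<in> ?q n"
      have sub: "submodule (?q k) R M" if "k \<le> r" for k
        by (rule ideal_smult_submodule[OF seq_ideal_props(2)[OF that]])
      have "seq_ideal R a n \<subseteq> seq_ideal R a ?i"
        unfolding seq_ideal_def[of R a n]
        by (rule R.genideal_minimal) (use seq_ideal_props[of ?i] i in auto)
      then have "?q n \<subseteq> ?q ?i"
        using sub[of ?i] i by (intro ideal_smult_least) (auto intro: smult_in_ideal_smult)
      then obtain G H where G: "G \<in> L" "G \<in> forms r M ?D" "ev G = \<zero>\<^bsub>M\<^esub>"
        and H: "H \<in> forms r M ?D" "supp_upto ?i H" and FGH: "F = (\<lambda>m. G m \<oplus>\<^bsub>M\<^esub> H m)"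
        using step.IH F evF by blast
      note Gc = formsD(1)[OF G(2)] and Hc = formsD(1)[OF H(1)]
      \<comment> \<open>The monomials of \<open>H\<close> that contain some \<open>X\<^sub>j\<close>
        with \<open>j \<le> n\<close> go into \<open>H1\<close>. The others are divisible by
        \<open>X\<^sub>n\<^sub>+\<^sub>1\<close>, and \<open>G1\<close> is the quotient; the test
        may be made on \<open>m\<close>, as adding the index \<open>n + 1\<close> does not affect
        it.\<close>
      define G1 where "G1 = (\<lambda>m. if \<exists>j\<in>#m. j \<le> n then \<zero>\<^bsub>M\<^esub> else H (add_mset ?i m))"
      define H1 where "H1 = (\<lambda>m. if \<exists>j\<in>#m. j \<le> n then H m else \<zero>\<^bsub>M\<^esub>)"
      have H1c: "H1 \<in> mpoly_carrier r M"
        by (rule mpoly_mono_support[OF Hc]) (use mpoly_carrierD(1)[OF Hc] in \<open>auto simp: H1_def split: if_splits\<close>)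
      have H1: "H1 \<in> forms r M ?D" "supp_upto n H1"
        using H1c formsD(2)[OF H(1)] by (auto simp: forms_def supp_upto_def H1_def split: if_splits)
      have G1: "G1 \<in> forms r M (Suc d)"
      proof -
        have G1H: "H (add_mset ?i m) \<noteq> \<zero>\<^bsub>M\<^esub>" if "G1 m \<noteq> \<zero>\<^bsub>M\<^esub>" for m
          using that by (auto simp: G1_def split: if_splits)
        have "add_mset ?i ` {m. G1 m \<noteq> \<zero>\<^bsub>M\<^esub>} \<subseteq> {m. H m \<noteq> \<zero>\<^bsub>M\<^esub>}" using G1H by blast
        then have "finite (add_mset ?i ` {m. G1 m \<noteq> \<zero>\<^bsub>M\<^esub>})"
          using mpoly_carrierD(2)[OF Hc] finite_subset by blast
        then have "finite {m. G1 m \<noteq> \<zero>\<^bsub>M\<^esub>}" by (rule finite_imageD) (simp add: inj_on_def)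
        moreover have "set_mset m \<subseteq> {1..r}" "size m = Suc d" if "G1 m \<noteq> \<zero>\<^bsub>M\<^esub>" for m
          using mpoly_carrierD(3)[OF Hc G1H[OF that]] formsD(2)[OF H(1) G1H[OF that]] by auto
        moreover have "G1 m \<in> carrier M" for m
          using mpoly_carrierD(1)[OF Hc] by (simp add: G1_def)
        ultimately show ?thesis unfolding forms_def mpoly_carrier_def by blast
      qed
      note G1c = formsD(1)[OF G1]
      have split: "H = (\<lambda>m. Xmul M ?i G1 m \<oplus>\<^bsub>M\<^esub> H1 m)"
      proof
        fix m
        show "H m = Xmul M ?i G1 m \<oplus>\<^bsub>M\<^esub> H1 m"
        proof (cases "\<exists>j\<in>#m. j \<le> n")
          case True
          then obtain j where j: "j \<in># m" "j \<le> n" by blast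
          \<comment> \<open>Removing one copy of \<open>n + 1\<close> leaves
            \<open>j \<le> n\<close> in place.\<close>
          then have "j \<in># m - {#?i#}" by (auto simp: in_diff_count)
          then have "Xmul M ?i G1 m = \<zero>\<^bsub>M\<^esub>" using j by (auto simp: Xmul_def G1_def)
          then show ?thesis using True mpoly_carrierD(1)[OF Hc] by (simp add: H1_def)
        next
          case False
          then have h1: "H1 m = \<zero>\<^bsub>M\<^esub>" by (simp add: H1_def)
          show ?thesis
          proof (cases "?i \<in># m")
            case True
            have "\<not> (\<exists>j\<in>#m - {#?i#}. j \<le> n)" using False in_diffD by fast
            then have "Xmul M ?i G1 m = H m" using True by (simp add: Xmul_def G1_def)
            then show ?thesis using h1 mpoly_carrierD(1)[OF Hc] by simp
          next
            case no: False
            have "H m = \<zero>\<^bsub>M\<^esub>"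
            proof (rule ccontr)
              assume "H m \<noteq> \<zero>\<^bsub>M\<^esub>"
              then obtain j where "j \<in># m" "j \<le> ?i" using H(2) by (auto simp: supp_upto_def)
              then show False using False no by (metis le_SucE)
            qed
            then show ?thesis using h1 no by (simp add: Xmul_def)
          qed
        qed
      qed
      note XG1c = Xmul_closed[OF G1c i(1)]
      have "ev F = ev H" using FGH eval_add[OF Gc Hc] G(3) eval_closed[OF Hc] by simp
      also have "\<dots> = ev H1 \<oplus>\<^bsub>M\<^esub> a ?i \<odot>\<^bsub>M\<^esub> ev G1"
        using eval_add[OF XG1c H1c] eval_Xmul[OF G1c i(1)] split eval_closed[OF H1c]
          eval_closed[OF XG1c] by (simp add: M.a_comm)
      finally have "a ?i \<odot>\<^bsub>M\<^esub> ev G1 \<in> ?q n"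
        using submodule_add_cancel[OF sub[OF i(2)] eval_in_ideal_smult[OF H1c i(2) H1(2)]]
          evF eval_closed[OF G1c] a_closed[OF i(1)] by simp
      \<comment> \<open>The colon hypothesis concerns elements of \<open>\<qq>M\<close> only; the
        value of \<open>G1\<close> is one because \<open>G1\<close> still has positive
        degree.\<close>
      moreover have "supp_upto r G1" by (rule supp_upto_forms[OF G1])
      then have "ev G1 \<in> ?q r" by (intro eval_in_ideal_smult G1c) auto
      ultimately have "ev G1 \<in> ?q n" using colon[OF i(1)] by simp
      then obtain G2 H2 where G2: "G2 \<in> L" "G2 \<in> forms r M (Suc d)" "ev G2 = \<zero>\<^bsub>M\<^esub>"
        and H2: "H2 \<in> forms r M (Suc d)" "supp_upto n H2" and G1e: "G1 = (\<lambda>m. G2 m \<oplus>\<^bsub>M\<^esub> H2 m)"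
        using Suc.IH[OF G1 i(2)] by blast
      note G2c = formsD(1)[OF G2(2)] and H2c = formsD(1)[OF H2(1)]
      \<comment> \<open>Substituting \<open>G1 = G2 + H2\<close> into
        \<open>F = G + X\<^sub>n\<^sub>+\<^sub>1 G1 + H1\<close> and regrouping; multiplication by
        \<open>X\<^sub>n\<^sub>+\<^sub>1\<close> preserves membership in \<open>L\<close>, vanishing
        at \<open>a\<close>, and \<open>supp_upto n\<close>.\<close>
      let ?G = "\<lambda>m. G m \<oplus>\<^bsub>M\<^esub> Xmul M ?i G2 m"
      let ?H = "\<lambda>m. Xmul M ?i H2 m \<oplus>\<^bsub>M\<^esub> H1 m"
      have XG2: "Xmul M ?i G2 \<in> forms r M ?D" "Xmul M ?i G2 \<in> L"
        using Xmul_forms[OF G2(2) i(1)] Xmul_in_submodule[OF L G2(1) i(1)] by auto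
      have XH2: "Xmul M ?i H2 \<in> forms r M ?D" using Xmul_forms[OF H2(1) i(1)] .
      have "?G \<in> L" using submodule_add[OF L G(1) XG2(2)] by simp
      moreover have "?G \<in> forms r M ?D" by (rule forms_add[OF G(2) XG2(1)])
      moreover have "ev ?G = \<zero>\<^bsub>M\<^esub>"
        using eval_add[OF Gc formsD(1)[OF XG2(1)]] eval_Xmul[OF G2c i(1)] G(3) G2(3) a_closed[OF i(1)]
        by simp
      moreover have "?H \<in> forms r M ?D" by (rule forms_add[OF XH2 H1(1)])
      moreover have "supp_upto n ?H"
        unfolding supp_upto_def
      proof (intro allI impI)
        fix m assume "?H m \<noteq> \<zero>\<^bsub>M\<^esub>"
        then have "Xmul M ?i H2 m \<noteq> \<zero>\<^bsub>M\<^esub> \<or> H1 m \<noteq> \<zero>\<^bsub>M\<^esub>" by auto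
        then show "\<exists>j\<in>#m. j \<le> n"
        proof
          assume "Xmul M ?i H2 m \<noteq> \<zero>\<^bsub>M\<^esub>"
          then have "H2 (m - {#?i#}) \<noteq> \<zero>\<^bsub>M\<^esub>" by (auto simp: Xmul_def split: if_splits)
          then show ?thesis using H2(2) in_diffD unfolding supp_upto_def by fast
        qed (use H1(2) in \<open>auto simp: supp_upto_def\<close>)
      qed
      moreover have "F = (\<lambda>m. ?G m \<oplus>\<^bsub>M\<^esub> ?H m)"
      proof
        fix m
        note c = mpoly_carrierD(1)[OF Gc, of m] mpoly_carrierD(1)[OF H1c, of m]
          mpoly_carrierD(1)[OF formsD(1)[OF XG2(1)], of m] mpoly_carrierD(1)[OF formsD(1)[OF XH2], of m]
        have "Xmul M ?i G1 m = Xmul M ?i G2 m \<oplus>\<^bsub>M\<^esub> Xmul M ?i H2 m"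
          by (simp add: Xmul_def G1e)
        then have "F m = G m \<oplus>\<^bsub>M\<^esub> ((Xmul M ?i G2 m \<oplus>\<^bsub>M\<^esub> Xmul M ?i H2 m) \<oplus>\<^bsub>M\<^esub> H1 m)"
          using FGH fun_cong[OF split, of m] by simp
        then show "F m = ?G m \<oplus>\<^bsub>M\<^esub> ?H m" using c by (simp add: M.a_assoc)
      qed
      ultimately show "\<exists>G\<in>L. \<exists>H\<in>forms r M ?D. G \<in> forms r M ?D \<and>
          ev G = \<zero>\<^bsub>M\<^esub> \<and> supp_upto n H \<and> F = (\<lambda>m. G m \<oplus>\<^bsub>M\<^esub> H m)"
        by (intro bexI[of _ ?G] bexI[of _ ?H]) auto
    qed
  qed
  then show ?case using Suc.prems by blast
qed

end

section \<open>Comparison of the Rees module and the symmetric module\<close>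

lemma (in module) sym_rel_submodule:
  "submodule (sym_rel R M r a) (mpoly_ring r R) (mpoly_module r M)"
  unfolding sym_rel_def
  by (rule submod_gen_submodule[OF mpoly_module_abelian_group])
    (auto simp: mpoly_smult_closed forms_def)

text \<open>It suffices to place each vanishing form in the submodule \<open>sym_rel\<close>.
  Positive degree is \<open>form_decomposition\<close> at \<open>k = 0\<close>; a form of degree 0
  is a constant, equal to its own value.\<close>

lemma (in eval_setup) rees_rel_eq_sym_rel:
  assumes colon: "\<And>i x. i \<in> {1..r} \<Longrightarrow> x \<in> ideal_smult R (seq_ideal R a r) M \<Longrightarrow>
      a i \<odot>\<^bsub>M\<^esub> x \<in> ideal_smult R (seq_ideal R a (i - 1)) M \<Longrightarrow>
      x \<in> ideal_smult R (seq_ideal R a (i - 1)) M"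
  shows "rees_rel R M r a = sym_rel R M r a"
proof
  note L = sym_rel_submodule
  have lin: "f \<in> sym_rel R M r a" if "f \<in> forms r M 1" "ev f = \<zero>\<^bsub>M\<^esub>" for f
    unfolding sym_rel_def by (rule subsetD[OF submod_gen_subset]) (use that in simp)
  have "f \<in> sym_rel R M r a" if f: "f \<in> forms r M d" and ev0: "ev f = \<zero>\<^bsub>M\<^esub>" for f d
  proof (cases d)
    case 0
    have fc: "f \<in> mpoly_carrier r M" by (rule formsD(1)[OF f])
    have const: "m = {#}" if "f m \<noteq> \<zero>\<^bsub>M\<^esub>" for m
      using formsD(2)[OF f that] 0 by simp
    have "ev f = (\<Oplus>\<^bsub>M\<^esub>m\<in>{{#}}. eval_monom R a m \<odot>\<^bsub>M\<^esub> f m)"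
      by (rule eval_eq_finsum[OF fc]) (use const in auto)
    then have "f {#} = \<zero>\<^bsub>M\<^esub>" using ev0 mpoly_carrierD(1)[OF fc] by simp
    then have "f = (\<lambda>m. \<zero>\<^bsub>M\<^esub>)" using const by metis
    then show ?thesis using submodule_zero[OF L] by simp
  next
    case (Suc d')
    have "ev f \<in> ideal_smult R (seq_ideal R a 0) M"
      using ev0 submodule_zero[OF ideal_smult_submodule[OF seq_ideal_props(2)]] by simp
    then obtain G H where G: "G \<in> sym_rel R M r a" "G \<in> forms r M d"
      and H: "H \<in> forms r M d" "supp_upto 0 H" and fGH: "f = (\<lambda>m. G m \<oplus>\<^bsub>M\<^esub> H m)"
      using form_decomposition[OF colon L lin, of f d' 0] f Suc by blast
    \<comment> \<open>Variables are numbered from 1, so no monomial in the support can contain an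
      index \<open>j \<le> 0\<close>.\<close>
    have "H m = \<zero>\<^bsub>M\<^esub>" for m
    proof (rule ccontr)
      assume m: "H m \<noteq> \<zero>\<^bsub>M\<^esub>"
      then obtain j where "j \<in># m" "j \<le> 0" using H(2) unfolding supp_upto_def by blast
      moreover have "set_mset m \<subseteq> {1..r}" by (rule mpoly_carrierD(3)[OF formsD(1)[OF H(1)] m])
      ultimately show False by auto
    qed
    then have "f = G" using fGH mpoly_carrierD(1)[OF formsD(1)[OF G(2)]] by simp
    then show ?thesis using G(1) by simp
  qed
  then show "rees_rel R M r a \<subseteq> sym_rel R M r a"
    unfolding rees_rel_def by (intro submod_gen_least[OF L]) auto
qed (rule sym_rel_subset_rees_rel)

text \<open>A coset of \<open>N\<close> is the coset of each of its elements, so the map is the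
  identity on \<open>M/N\<close>; the homomorphism conditions then reduce to closure of the
  operations.\<close>

lemma quot_map_self_mod_iso:
  assumes M: "abelian_group M" and N: "submodule N A M"
    and closed: "\<And>c x. c \<in> carrier A \<Longrightarrow> x \<in> carrier M \<Longrightarrow> c \<odot>\<^bsub>M\<^esub> x \<in> carrier M"
    and distr: "\<And>c x y. c \<in> carrier A \<Longrightarrow> x \<in> carrier M \<Longrightarrow> y \<in> carrier M \<Longrightarrow>
      c \<odot>\<^bsub>M\<^esub> (x \<oplus>\<^bsub>M\<^esub> y) = c \<odot>\<^bsub>M\<^esub> x \<oplus>\<^bsub>M\<^esub> c \<odot>\<^bsub>M\<^esub> y"
  shows "quot_map M N \<in> mod_iso A (quot_module M N) (quot_module M N)"
proof -
  interpret abelian_subgroup N M by (rule abelian_subgroup_submodule[OF M N])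
  interpret Q: abelian_group "quot_module M N" by (rule quot_abelian_group[OF M N])
  have id: "quot_map M N X = X" if "X \<in> carrier (quot_module M N)" for X
  proof -
    obtain x where x: "x \<in> carrier M" "X = N +>\<^bsub>M\<^esub> x" using \<open>X \<in> _\<close> by (auto simp: quot_carrier_iff)
    have "N +>\<^bsub>M\<^esub> y = X" if "y \<in> X" for y
      using a_repr_independence'[of y x] that x by simp
    moreover have "x \<in> X" using x a_rcos_self by simp
    ultimately show ?thesis unfolding quot_map_def by (metis (no_types) SUP_eq_const empty_iff)
  qed
  have "c \<odot>\<^bsub>quot_module M N\<^esub> X \<in> carrier (quot_module M N)"
    if "c \<in> carrier A" "X \<in> carrier (quot_module M N)" for c X
  proof -
    obtain x where x: "x \<in> carrier M" "X = N +>\<^bsub>M\<^esub> x" using \<open>X \<in> _\<close> by (auto simp: quot_carrier_iff)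
    then have "c \<odot>\<^bsub>quot_module M N\<^esub> X = N +>\<^bsub>M\<^esub> (c \<odot>\<^bsub>M\<^esub> x)"
      using quot_smult[OF M N that(1) x(1)] closed[OF that(1)] distr[OF that(1)] by simp
    then show ?thesis using closed[OF that(1) x(1)] by (auto simp: quot_carrier_iff)
  qed
  moreover have "bij_betw (quot_map M N) (carrier (quot_module M N)) (carrier (quot_module M N))"
    using id by (simp add: bij_betw_def inj_on_def cong: image_cong)
  ultimately show ?thesis by (simp add: mod_iso_def mod_hom_def id Pi_def)
qed

theorem theorem3p3:
  fixes A :: "('a, 'x) ring_scheme" and M :: "('a, 'b, 'y) module_scheme"
    and \<mm> :: "'a set" and r :: nat and a :: "nat \<Rightarrow> 'a"
  assumes "local_ring A \<mm>"
    and "fin_gen_module A M"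
    and "r \<ge> 1"
    and "\<And>i. i \<in> {1..r} \<Longrightarrow> a i \<in> \<mm>"
    and "abs_superficial A M r a"
    and "colon M (ideal_smult A (seq_ideal A a (r - 1)) M) (a r) \<noteq> carrier M"
  shows "sym_to_rees A M r a
    \<in> mod_iso (mpoly_ring r A) (sym_module A M r a) (rees_module A M r a)"
proof -
  interpret module A M using assms(2) by (simp add: fin_gen_module_def)
  have "ideal \<mm> A"
    using assms(1) maximalideal.axioms(1) unfolding local_ring_def by blast
  then have "a i \<in> carrier A" if "i \<in> {1..r}" for i
    using assms(4)[OF that] ideal.Icarr by metis
  then interpret eval_setup A M r a by unfold_locales
  have eq: "rees_rel A M r a = sym_rel A M r a"
    by (rule rees_rel_eq_sym_rel[OF abs_superficial_colon[OF assms(1,2) assms(4) assms(5)]])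
  show ?thesis
    \<comment> \<open>Rewriting with \<open>eq\<close> turns source and target into the same
      quotient. Below, sums of polynomials are kept folded so that
      \<open>mpoly_smult_r_distr\<close> matches.\<close>
    unfolding sym_to_rees_def sym_module_def rees_module_def eq
    by (intro quot_map_self_mod_iso mpoly_module_abelian_group sym_rel_submodule)
      (auto simp: mpoly_smult_closed mpoly_smult_r_distr simp del: mpoly_module_simps(3))
qed

end
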